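(* Let $\epsilon\in(0,1)$, $\lambda_c=\epsilon^{1/3}$, $\eta\in(0,\tfrac13)$, let $\rho_l\in(0,1)$ be a fixed constant, and let $\{s^{(i)}\}_{i\ge 0}$ be generated by the QQR method described in the context, applied to $m_3$. In an iteration $i$ with $\|g_i\|>\epsilon$ and $\|g_{i+1}\|>\epsilon$, the QQR algorithm satisfies the following improvements, where $\ge\mathcal O(\epsilon^{t})$ means: at least a positive constant, independent of $i$ and of $\epsilon$, times $\epsilon^{t}$. 1. (Locally strictly convex case) If $\lambda_{\min}[H_i]\ge\lambda_c$, then $m_3(s^{(i)})-m_3(s^{(i+1)})\ge\mathcal O(\epsilon^{4/3})$, or there is linear convergence in gradient norm, $\|g_{i+1}\|\le\rho_l\|g_i\|$. 2. (Locally nonconvex case) If $\lambda_{\min}[H_i]\le-\lambda_c$, then $m_3(s^{(i)})-m_3(s^{(i+1)})\ge\mathcal O(\epsilon)$, or there is a constant error reduction, $m_3(s^{(i)})-m_3(s^{(i+1)})\ge\check c_2$ with $\check c_2>0$ independent of $i$, $\lambda_c$ and $\epsilon$. 3. (Locally nearly convex case) If $|\lambda_{\min}[H_i]|<\lambda_c$, then $m_3(s^{(i)})-m_3(s^{(i+1)})\ge\mathcal O(\epsilon^{3/2})$, or there is linear convergence in gradient norm, $\|g_{i+1}\|\le\rho_l\|g_i\|$.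
   Context: Norms are Euclidean. Let $f_0\in\mathbb R$, $g\in\mathbb R^n$, $H\in\mathbb R^{n\times n}$ symmetric, $T\in\mathbb R^{n\times n\times n}$ a symmetric third-order tensor, $\sigma>0$, and $$m_3(s)=f_0+g^Ts+\tfrac12 s^THs+\tfrac16T[s]^3+\tfrac{\sigma}{4}\|s\|^4,\qquad s\in\mathbb R^n .$$ For a point $s^{(i)}$ write $f_i=m_3(s^{(i)})$, $g_i=\nabla m_3(s^{(i)})$, $H_i=\nabla^2m_3(s^{(i)})$. $\lambda_{\min}[\cdot],\lambda_{\max}[\cdot]$ denote smallest/largest eigenvalue. Let $\lambda_0=\max\{-\lambda_{\min}[H],0\}$, $\Lambda_0=\max_{\|u\|=1}T[u]^3$, and let $r_c>0$ be the unique solution of $\sigma=4\big(\frac{\|g\|}{r_c^3}+\frac{\lambda_0}{2r_c^2}+\frac{\Lambda_0}{6r_c}\big)$. Set $L_H=\Lambda_0+6\sigma r_c$. QQR method (tolerance $\epsilon$, threshold $\lambda_c>0$, constant $\eta\in(0,\frac13)$): start from $s^{(0)}=0$. While $\|g_i\|>\epsilon$, let $s_+^{(i)}$ be a global minimizer over $s\in\mathbb R^n$ of $$M_{\alpha^+}(s^{(i)},s)=f_i+g_i^Ts+\tfrac{\alpha_1^+}{2}s^T(H_i+\tilde pI_n)s+\tfrac{\sigma}{4}\alpha_2^+\|s\|^4 ,$$ and compute the ratio $$\rho(s_+^{(i)})=\frac{m_3(s^{(i)})-m_3(s^{(i)}+s_+^{(i)})}{m_3(s^{(i)})-M_{\alpha^+}(s^{(i)},s_+^{(i)})}.$$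 If $\rho(s_+^{(i)})\ge\eta$, set $s^{(i+1)}=s^{(i)}+s_+^{(i)}$; otherwise set $s^{(i+1)}=s^{(i)}$ and adjust $\alpha_1^+,\alpha_2^+,\tilde p$ adaptively. The parameters are chosen as follows (with these choices the ratio test $\rho(s_+^{(i)})\ge\eta$ is satisfied): (a) if $\lambda_{\min}[H_i]\ge\lambda_c$: $\tilde p=0$, $\alpha_1^+=1+a$ with $\epsilon^{1/2}\le a\lambda_c\le\|g_i\|^{1/2}$, and $\alpha_2^+=1+d$ with $d>\frac{L_H^2}{18a\lambda_c\sigma}$; (b) if $|\lambda_{\min}[H_i]|<\lambda_c$: $\alpha_1^+=1$, $\epsilon^{1/2}\le\tilde p\le\|g_i\|^{1/2}$, and $\alpha_2^+=1+d$ with $d>\frac{L_H^2}{18\tilde p\sigma}$; (c) if $\lambda_{\min}[H_i]\le-\lambda_c$: $\tilde p=0$, $\alpha_1^+\in\big[\max\{\frac{2}{3(1-\eta)},\,1-\frac{|\lambda_{\min}[H_i]|}{2|\lambda_{\max}[H_i]|}\},1\big]$, and $\alpha_2^+=\eta^{-1}(1+d)$ with $d>\frac{L_H^2}{3\sigma\lambda_c}$.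
   Formalization: In (a)–(c), d is also assumed to be at most κ times its stated lower bound, for an arbitrary fixed κ>1 on which the constants may depend; with d unbounded the steps shrink to 0 and no uniform decrease or gradient reduction holds. *)

theory Defs
  imports "HOL-Analysis.Analysis"
begin

definition grad :: "(real^'n \<Rightarrow> real) \<Rightarrow> real^'n \<Rightarrow> real^'n" where
  "grad f x = (THE D. GDERIV f x :> D)"

definition hess :: "(real^'n \<Rightarrow> real) \<Rightarrow> real^'n \<Rightarrow> real^'n^'n" where
  "hess f x = jacobian (grad f) (at x)"

definition eigenvalues :: "real^'n^'n \<Rightarrow> real set" where
  "eigenvalues A = {l. \<exists>v. v \<noteq> 0 \<and> A *v v = l *\<^sub>R v}"

(* Min and Max are meaningful here because a real symmetric matrix has a finite, nonempty
   set of eigenvalues. *)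
definition lambda_min :: "real^'n^'n \<Rightarrow> real" where
  "lambda_min A = Min (eigenvalues A)"

definition lambda_max :: "real^'n^'n \<Rightarrow> real" where
  "lambda_max A = Max (eigenvalues A)"

(* The two transpositions generate all permutations of the three indices. *)
definition symmetric_tensor :: "real^'n^'n^'n \<Rightarrow> bool" where
  "symmetric_tensor T \<longleftrightarrow> (\<forall>i j k. T $ i $ j $ k = T $ j $ i $ k \<and> T $ i $ j $ k = T $ i $ k $ j)"

definition tensor_cube :: "real^'n^'n^'n \<Rightarrow> real^'n \<Rightarrow> real" where
  "tensor_cube T s = (\<Sum>i\<in>UNIV. \<Sum>j\<in>UNIV. \<Sum>k\<in>UNIV. T $ i $ j $ k * s $ i * s $ j * s $ k)"

definition m3 :: "real \<Rightarrow> real^'n \<Rightarrow> real^'n^'n \<Rightarrow> real^'n^'n^'n \<Rightarrow> real \<Rightarrow> real^'n \<Rightarrow> real" where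
  "m3 f0 g H T \<sigma> s =
     f0 + g \<bullet> s + 1/2 * (s \<bullet> (H *v s)) + 1/6 * tensor_cube T s + \<sigma>/4 * norm s ^ 4"

definition lambda0 :: "real^'n^'n \<Rightarrow> real" where
  "lambda0 H = max (- lambda_min H) 0"

(* The supremum is attained: the unit sphere is compact and nonempty. *)
definition Lambda0 :: "real^'n^'n^'n \<Rightarrow> real" where
  "Lambda0 T = (SUP u\<in>sphere 0 1. tensor_cube T u)"

(* The solution exists (and is then unique) unless g, lambda0 H and Lambda0 T all vanish;
   in that case grad m3 vanishes at the starting point 0. *)
definition rc :: "real^'n \<Rightarrow> real^'n^'n \<Rightarrow> real^'n^'n^'n \<Rightarrow> real \<Rightarrow> real" where
  "rc g H T \<sigma> =
     (THE r. r > 0 \<and> \<sigma> = 4 * (norm g / r^3 + lambda0 H / (2 * r^2) + Lambda0 T / (6 * r)))"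

definition LH :: "real^'n \<Rightarrow> real^'n^'n \<Rightarrow> real^'n^'n^'n \<Rightarrow> real \<Rightarrow> real" where
  "LH g H T \<sigma> = Lambda0 T + 6 * \<sigma> * rc g H T \<sigma>"

definition quad_quartic_model ::
  "real \<Rightarrow> (real^'n \<Rightarrow> real) \<Rightarrow> real \<Rightarrow> real \<Rightarrow> real \<Rightarrow> real^'n \<Rightarrow> real^'n \<Rightarrow> real" where
  "quad_quartic_model \<sigma> m \<alpha>1 \<alpha>2 p x s =
     m x + grad m x \<bullet> s + \<alpha>1/2 * (s \<bullet> ((hess m x + p *\<^sub>R mat 1) *v s)) + \<sigma>/4 * \<alpha>2 * norm s ^ 4"

definition decrease_ratio ::
  "real \<Rightarrow> (real^'n \<Rightarrow> real) \<Rightarrow> real \<Rightarrow> real \<Rightarrow> real \<Rightarrow> real^'n \<Rightarrow> real^'n \<Rightarrow> real" where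
  "decrease_ratio \<sigma> m \<alpha>1 \<alpha>2 p x s =
     (m x - m (x + s)) / (m x - quad_quartic_model \<sigma> m \<alpha>1 \<alpha>2 p x s)"

(* d exceeds its lower bound b, by at most the factor \<kappa>.  An upper limit is indispensable:
   as d grows the steps of the method shrink to 0, so no decrease that is uniform in all
   d > b can hold. *)
definition admissible :: "real \<Rightarrow> real \<Rightarrow> real \<Rightarrow> bool" where
  "admissible \<kappa> b d \<longleftrightarrow> b < d \<and> d \<le> \<kappa> * b"

(* In the third case a vanishing largest eigenvalue makes the quotient infinite, so that the
   corresponding lower bound on \<alpha>1 is void. *)
definition qqr_parameters ::
  "real \<Rightarrow> real \<Rightarrow> real \<Rightarrow> real \<Rightarrow> real \<Rightarrow> real \<Rightarrow> real^'n \<Rightarrow> real^'n^'n \<Rightarrow> real \<Rightarrow> real \<Rightarrow> real \<Rightarrow> bool" where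
  "qqr_parameters \<kappa> \<sigma> L \<epsilon> lc \<eta> gi Hi \<alpha>1 \<alpha>2 p \<longleftrightarrow>
     (lambda_min Hi \<ge> lc \<longrightarrow>
        p = 0 \<and>
        (\<exists>a d. \<alpha>1 = 1 + a \<and> sqrt \<epsilon> \<le> a * lc \<and> a * lc \<le> sqrt (norm gi) \<and>
               \<alpha>2 = 1 + d \<and> admissible \<kappa> (L^2 / (18 * a * lc * \<sigma>)) d)) \<and>
     (\<bar>lambda_min Hi\<bar> < lc \<longrightarrow>
        \<alpha>1 = 1 \<and> sqrt \<epsilon> \<le> p \<and> p \<le> sqrt (norm gi) \<and>
        (\<exists>d. \<alpha>2 = 1 + d \<and> admissible \<kappa> (L^2 / (18 * p * \<sigma>)) d)) \<and>
     (lambda_min Hi \<le> - lc \<longrightarrow>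
        p = 0 \<and>
        2 / (3 * (1 - \<eta>)) \<le> \<alpha>1 \<and>
        (lambda_max Hi \<noteq> 0 \<longrightarrow> 1 - \<bar>lambda_min Hi\<bar> / (2 * \<bar>lambda_max Hi\<bar>) \<le> \<alpha>1) \<and>
        \<alpha>1 \<le> 1 \<and>
        (\<exists>d. \<alpha>2 = (1 + d) / \<eta> \<and> admissible \<kappa> (L^2 / (3 * \<sigma> * lc)) d))"

definition qqr_step ::
  "real \<Rightarrow> real \<Rightarrow> real \<Rightarrow> (real^'n \<Rightarrow> real) \<Rightarrow> real \<Rightarrow> real \<Rightarrow> real \<Rightarrow> real^'n \<Rightarrow> real^'n \<Rightarrow> bool" where
  "qqr_step \<kappa> \<sigma> L m \<epsilon> lc \<eta> x x' \<longleftrightarrow>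
     (\<exists>\<alpha>1 \<alpha>2 p sp.
        qqr_parameters \<kappa> \<sigma> L \<epsilon> lc \<eta> (grad m x) (hess m x) \<alpha>1 \<alpha>2 p \<and>
        is_arg_min (quad_quartic_model \<sigma> m \<alpha>1 \<alpha>2 p x) (\<lambda>_. True) sp \<and>
        x' = (if decrease_ratio \<sigma> m \<alpha>1 \<alpha>2 p x sp \<ge> \<eta> then x + sp else x))"

(* The sequence is continued constantly once the stopping test norm (grad m x) \<le> \<epsilon> holds. *)
definition qqr_sequence ::
  "real \<Rightarrow> real \<Rightarrow> real \<Rightarrow> (real^'n \<Rightarrow> real) \<Rightarrow> real \<Rightarrow> real \<Rightarrow> real \<Rightarrow> (nat \<Rightarrow> real^'n) \<Rightarrow> bool" where
  "qqr_sequence \<kappa> \<sigma> L m \<epsilon> lc \<eta> s \<longleftrightarrow>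
     s 0 = 0 \<and>
     (\<forall>i. if norm (grad m (s i)) > \<epsilon>
          then qqr_step \<kappa> \<sigma> L m \<epsilon> lc \<eta> (s i) (s (Suc i))
          else s (Suc i) = s i)"

end

theory Submission
  imports Defs
begin

text \<open>
  Since \<open>m3\<close> is a quartic polynomial, its Taylor expansion at an iterate is exact: the cubic
  term is at most \<open>LH / 6\<close> times the cube of the step length because all iterates lie in the
  ball of radius \<open>rc\<close>, and the quartic term is the one of the model. A global minimizer
  \<open>s\<close> of the model satisfies \<open>g\<^sub>i + A s + c \<parallel>s\<parallel>\<^sup>2 s = 0\<close> with
  \<open>A + c \<parallel>s\<parallel>\<^sup>2 I\<close> positive semidefinite, where \<open>c = \<sigma> \<alpha>2\<close>; hence the model
  decreases by at least \<open>c \<parallel>s\<parallel>\<^sup>4 / 4\<close>, and the lower bounds on \<open>d\<close> make the ratio test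
  succeed. A step that is long in comparison with \<open>p\<close> (nearly convex case) or with
  \<open>sqrt \<epsilon>\<close> (strictly convex case) yields the decrease; after a short step the stationarity
  equation leaves only small terms in the new gradient. The exception is a strictly convex
  iteration with large \<open>a\<close>: there \<open>\<parallel>A s\<parallel>\<^sup>2 \<le> B (s \<bullet> A s)\<close> turns the
  large gradient into a decrease. In the nonconvex case, semidefiniteness alone forces
  a long step.
\<close>

section \<open>Symmetric matrices\<close>

text \<open>Symmetry in terms of the bilinear form is what can be checked for \<open>hess\<close>,
  which is accessible only through its action on vectors.\<close>

lemma transpose_eq_self_iff:
  fixes A :: "real^'n^'n"
  shows "transpose A = A \<longleftrightarrow> (\<forall>x y. x \<bullet> (A *v y) = y \<bullet> (A *v x))"
proof
  assume "transpose A = A"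
  then show "\<forall>x y. x \<bullet> (A *v y) = y \<bullet> (A *v x)"
    by (metis dot_lmul_matrix inner_commute transpose_matrix_vector)
next
  assume *: "\<forall>x y. x \<bullet> (A *v y) = y \<bullet> (A *v x)"
  have "transpose A *v x = A *v x" for x
  proof (rule vector_eq_ldot[THEN iffD1], rule allI)
    show "y \<bullet> (transpose A *v x) = y \<bullet> (A *v x)" for y
      by (metis * dot_lmul_matrix inner_commute transpose_matrix_vector)
  qed
  then show "transpose A = A"
    by (simp add: matrix_eq)
qed

lemma symmetric_matrix_inner:
  fixes A :: "real^'n^'n"
  assumes "transpose A = A"
  shows "x \<bullet> (A *v y) = y \<bullet> (A *v x)"
  using assms transpose_eq_self_iff by blast

text \<open>Eigenvectors of distinct eigenvalues of a symmetric matrix are orthogonal, so one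
  eigenvector per eigenvalue gives an independent set, which is finite. Hence \<open>Min\<close> in
  \<open>lambda_min\<close> is a true minimum.\<close>

lemma finite_eigenvalues:
  fixes A :: "real^'n^'n"
  assumes sym: "transpose A = A"
  shows "finite (eigenvalues A)"
proof -
  define v where "v l = (SOME v. v \<noteq> 0 \<and> A *v v = l *\<^sub>R v)" for l
  have v: "v l \<noteq> 0" "A *v v l = l *\<^sub>R v l" if "l \<in> eigenvalues A" for l
    using that someI_ex[of "\<lambda>v. v \<noteq> 0 \<and> A *v v = l *\<^sub>R v"]
    unfolding eigenvalues_def v_def by auto
  have orth: "v l \<bullet> v k = 0" if "l \<in> eigenvalues A" "k \<in> eigenvalues A" "l \<noteq> k" for l k
  proof -
    have "k * (v l \<bullet> v k) = l * (v l \<bullet> v k)"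
      using symmetric_matrix_inner[OF sym, of "v l" "v k"] v[OF that(1)] v[OF that(2)]
      by (simp add: inner_commute)
    with that(3) show ?thesis by simp
  qed
  have inj: "inj_on v (eigenvalues A)"
    by (rule inj_onI) (metis inner_eq_zero_iff orth v(1))
  have "pairwise orthogonal (v ` eigenvalues A)"
    unfolding pairwise_def orthogonal_def using orth by auto
  then have "independent (v ` eigenvalues A)"
    using v(1) by (intro pairwise_orthogonal_independent) auto
  then have "finite (v ` eigenvalues A)"
    using independent_imp_finite by blast
  with inj show ?thesis by (rule finite_imageD[rotated])
qed

text \<open>Variational characterization: a minimizer \<open>v\<close> of the quadratic form on the
  unit sphere is an eigenvector, because moving from \<open>v\<close> against the residual
  \<open>z\<close> would otherwise lower the shifted form \<open>q\<close> below 0.\<close>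

lemma lambda_min_symmetric:
  fixes A :: "real^'n^'n"
  assumes sym: "transpose A = A"
  shows lambda_min_eigenvalue: "lambda_min A \<in> eigenvalues A"
    and lambda_min_le_quadratic: "lambda_min A * norm x ^ 2 \<le> x \<bullet> (A *v x)"
proof -
  have cont: "continuous_on (sphere 0 1) (\<lambda>x. x \<bullet> (A *v x))"
    by (intro continuous_intros linear_continuous_on) simp
  have nonempty: "sphere (0::real^'n) 1 \<noteq> {}"
    by simp
  obtain v where v: "v \<in> sphere 0 1"
    and vmin: "\<And>y. y \<in> sphere 0 1 \<Longrightarrow> v \<bullet> (A *v v) \<le> y \<bullet> (A *v y)"
    using continuous_attains_inf[OF compact_sphere nonempty cont] by blast
  define l where "l = v \<bullet> (A *v v)"
  have l_le: "l * norm y ^ 2 \<le> y \<bullet> (A *v y)" for y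
  proof (cases "y = 0")
    case False
    have "l \<le> sgn y \<bullet> (A *v sgn y)"
      unfolding l_def using False by (intro vmin) (simp add: norm_sgn)
    also have "\<dots> = (y \<bullet> (A *v y)) / norm y ^ 2"
      by (simp add: sgn_div_norm matrix_vector_mult_scaleR power2_eq_square divide_simps)
    finally show ?thesis using False by (simp add: field_simps)
  qed simp
  define z where "z = A *v v - l *\<^sub>R v"
  define q where "q w = w \<bullet> (A *v w) - l * (w \<bullet> w)" for w
  have q_nonneg: "q w \<ge> 0" for w
    using l_le[of w] by (simp add: q_def power2_norm_eq_inner)
  have "q v = 0"
    using v by (simp add: q_def l_def norm_eq_1)
  then have expand: "q (v - t *\<^sub>R z) = - (2 * t * (z \<bullet> z)) + t\<^sup>2 * q z" for t
    using symmetric_matrix_inner[OF sym, of v z]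
    by (simp add: q_def matrix_vector_mult_diff_distrib matrix_vector_mult_scaleR inner_diff_left
        inner_diff_right z_def power2_eq_square algebra_simps inner_commute)
  have "z \<bullet> z = 0"
  proof (rule ccontr)
    assume "z \<bullet> z \<noteq> 0"
    then have zz: "z \<bullet> z > 0" by (simp add: order_less_le)
    have pos: "q z + 1 > 0" using q_nonneg[of z] by simp
    \<comment> \<open>Any positive \<open>t\<close> with
      \<open>t * q z < 2 * (z \<bullet> z)\<close> makes \<open>expand\<close> negative; the
      \<open>+ 1\<close> keeps the denominator positive.\<close>
    define t where "t = (z \<bullet> z) / (q z + 1)"
    have "t * (q z + 1) = z \<bullet> z" using pos by (simp add: t_def)
    moreover have "t > 0" using zz pos by (simp add: t_def)
    moreover have "t * q z \<ge> 2 * (z \<bullet> z)"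
    proof -
      have "0 \<le> t * (t * q z - 2 * (z \<bullet> z))"
        using q_nonneg[of "v - t *\<^sub>R z"] expand[of t] by (simp add: algebra_simps power2_eq_square)
      with \<open>t > 0\<close> show ?thesis by (simp add: zero_le_mult_iff)
    qed
    ultimately show False using zz by (simp add: algebra_simps)
  qed
  then have "A *v v = l *\<^sub>R v" by (simp add: z_def)
  moreover have "v \<noteq> 0" using v by auto
  ultimately have l_in: "l \<in> eigenvalues A" unfolding eigenvalues_def by blast
  have "l \<le> k" if k: "k \<in> eigenvalues A" for k
  proof -
    obtain w where w: "w \<noteq> 0" "A *v w = k *\<^sub>R w"
      using k unfolding eigenvalues_def by blast
    with l_le[of w] show ?thesis by (simp add: power2_norm_eq_inner)
  qed
  then have "lambda_min A = l"
    unfolding lambda_min_def using finite_eigenvalues[OF sym] l_in by (intro Min_eqI) auto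
  then show "lambda_min A \<in> eigenvalues A" "lambda_min A * norm x ^ 2 \<le> x \<bullet> (A *v x)"
    using l_in l_le by auto
qed

text \<open>Evaluating the form at \<open>B *\<^sub>R x - A *v x\<close> gives the bound without a
  spectral decomposition. It later turns a large \<open>A *v x\<close> into a large quadratic
  term.\<close>

lemma norm_matrix_vector_mult_square_le:
  fixes A :: "real^'n^'n"
  assumes sym: "transpose A = A"
    and psd: "\<And>x. 0 \<le> x \<bullet> (A *v x)"
    and bnd: "\<And>x. norm (A *v x) \<le> B * norm x" and "B > 0"
  shows "norm (A *v x) ^ 2 \<le> B * (x \<bullet> (A *v x))"
proof -
  define y where "y = A *v x"
  have "0 \<le> (B *\<^sub>R x - y) \<bullet> (A *v (B *\<^sub>R x - y))" by (rule psd)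
  also have "\<dots> = B\<^sup>2 * (x \<bullet> y) - 2 * B * (y \<bullet> y) + y \<bullet> (A *v y)"
    using symmetric_matrix_inner[OF sym, of x y]
    by (simp add: matrix_vector_mult_diff_distrib matrix_vector_mult_scaleR inner_diff_left
        inner_diff_right power2_eq_square algebra_simps inner_commute flip: y_def)
  also have "y \<bullet> (A *v y) \<le> norm y * (B * norm y)"
    using norm_cauchy_schwarz[of y "A *v y"] bnd[of y] mult_left_mono[OF bnd[of y], of "norm y"]
    by simp
  also have "\<dots> = B * (y \<bullet> y)" by (simp add: dot_square_norm power2_eq_square)
  finally have "0 \<le> B * (B * (x \<bullet> y) - y \<bullet> y)"
    by (simp add: algebra_simps power2_eq_square)
  with \<open>B > 0\<close> show ?thesis
    by (simp add: zero_le_mult_iff power2_norm_eq_inner flip: y_def)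
qed

section \<open>The model and its derivatives\<close>

text \<open>The contraction of \<open>T\<close> that leaves one index free. Being bilinear, it is
  covered by the general product rule.\<close>

definition tensor_apply :: "real^'n^'n^'n \<Rightarrow> real^'n \<Rightarrow> real^'n \<Rightarrow> real^'n" where
  "tensor_apply T x y = (\<chi> i. \<Sum>j\<in>UNIV. \<Sum>k\<in>UNIV. T $ i $ j $ k * x $ j * y $ k)"

lemma bounded_bilinear_tensor_apply: "bounded_bilinear (tensor_apply T)"
  unfolding bilinear_conv_bounded_bilinear[symmetric] bilinear_def tensor_apply_def
  by (auto intro!: linearI simp: vec_eq_iff sum.distrib sum_distrib_left algebra_simps)

lemma tensor_cube_eq: "tensor_cube T s = s \<bullet> tensor_apply T s s"
  by (simp add: tensor_cube_def tensor_apply_def inner_vec_def sum_distrib_left mult_ac)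

lemma tensor_cube_scaleR: "tensor_cube T (c *\<^sub>R s) = c ^ 3 * tensor_cube T s"
  by (simp add: tensor_cube_def sum_distrib_left power3_eq_cube mult_ac)

lemma tensor_apply_commute:
  assumes "symmetric_tensor T"
  shows "tensor_apply T x y = tensor_apply T y x"
proof -
  have "(\<Sum>j\<in>UNIV. \<Sum>k\<in>UNIV. T $ i $ j $ k * x $ j * y $ k) =
    (\<Sum>j\<in>UNIV. \<Sum>k\<in>UNIV. T $ i $ j $ k * y $ j * x $ k)" for i
    using assms unfolding symmetric_tensor_def
    by (subst sum.swap) (auto intro!: sum.cong simp: mult_ac)
  then show ?thesis by (simp add: tensor_apply_def)
qed

lemma inner_tensor_apply_swap:
  assumes "symmetric_tensor T"
  shows "x \<bullet> tensor_apply T y z = y \<bullet> tensor_apply T x z"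
proof -
  have "x \<bullet> tensor_apply T y z = (\<Sum>i\<in>UNIV. \<Sum>j\<in>UNIV. \<Sum>k\<in>UNIV. T $ i $ j $ k * x $ i * y $ j * z $ k)"
    by (simp add: tensor_apply_def inner_vec_def sum_distrib_left mult_ac)
  also have "\<dots> = (\<Sum>i\<in>UNIV. \<Sum>j\<in>UNIV. \<Sum>k\<in>UNIV. T $ i $ j $ k * x $ j * y $ i * z $ k)"
    using assms unfolding symmetric_tensor_def
    by (subst sum.swap) (auto intro!: sum.cong simp: mult_ac)
  also have "\<dots> = y \<bullet> tensor_apply T x z"
    by (simp add: tensor_apply_def inner_vec_def sum_distrib_left mult_ac)
  finally show ?thesis .
qed

section \<open>Gradient, Hessian and exact Taylor expansion of \<open>m3\<close>\<close>

lemma grad_eqI: "GDERIV f x :> D \<Longrightarrow> grad f x = D"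
proof -
  assume D: "GDERIV f x :> D"
  have "E = D" if "GDERIV f x :> E" for E
    using has_derivative_unique[OF that[unfolded gderiv_def] D[unfolded gderiv_def]]
    by (metis vector_eq_ldot)
  with D show ?thesis unfolding grad_def by blast
qed

text \<open>Makes the quartic term a polynomial in inner products, so that it can be differentiated
  at 0 as well, where \<open>norm\<close> cannot.\<close>

lemma norm_pow4_eq_inner: "norm (x::'a::real_inner) ^ 4 = (x \<bullet> x)\<^sup>2"
  by (simp add: dot_square_norm flip: power_mult)

text \<open>Symmetry of \<open>H\<close> merges two terms of the product rule and symmetry of
  \<open>T\<close> merges three, which changes the factors 1/2 and 1/6 into 1 and 1/2.\<close>

lemma GDERIV_m3:
  fixes g :: "real^'n"
  assumes sym: "transpose H = H" and T: "symmetric_tensor T"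
  shows "GDERIV (m3 f0 g H T \<sigma>) x :>
    g + H *v x + (1/2) *\<^sub>R tensor_apply T x x + (\<sigma> * norm x ^ 2) *\<^sub>R x"
proof -
  note T_deriv = bounded_bilinear.FDERIV[OF bounded_bilinear_tensor_apply[of T]]
  have H_deriv: "((\<lambda>x. H *v x) has_derivative (\<lambda>h. H *v h)) (at x)"
    by (rule bounded_linear_imp_has_derivative) simp
  show ?thesis
    unfolding gderiv_def m3_def tensor_cube_eq norm_pow4_eq_inner
    apply (rule has_derivative_eq_rhs)
     apply (rule derivative_eq_intros T_deriv H_deriv refl)+
    apply (rule ext)
    subgoal for h
      using symmetric_matrix_inner[OF sym, of x h]
        tensor_apply_commute[OF T, of x h] inner_tensor_apply_swap[OF T, of x h x]
      by (simp only: inner_add_left inner_add_right)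
        (simp add: inner_add_left inner_add_right inner_commute power2_norm_eq_inner algebra_simps)
    done
qed

lemmas grad_m3 = grad_eqI[OF GDERIV_m3]

text \<open>The derivative of the explicit gradient is computed directly; uniqueness of derivatives
  identifies it with the action of the Jacobian matrix.\<close>

lemma hess_m3_mult:
  fixes g :: "real^'n"
  assumes sym: "transpose H = H" and T: "symmetric_tensor T"
  shows "hess (m3 f0 g H T \<sigma>) x *v h =
    H *v h + tensor_apply T x h + (\<sigma> * norm x ^ 2) *\<^sub>R h + (2 * \<sigma> * (x \<bullet> h)) *\<^sub>R x"
proof -
  note T_deriv = bounded_bilinear.FDERIV[OF bounded_bilinear_tensor_apply[of T]]
  have H_deriv: "((\<lambda>x. H *v x) has_derivative (\<lambda>h. H *v h)) (at x)"
    by (rule bounded_linear_imp_has_derivative) simp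
  have eq: "grad (m3 f0 g H T \<sigma>) =
    (\<lambda>x. g + H *v x + (1/2) *\<^sub>R tensor_apply T x x + (\<sigma> * (x \<bullet> x)) *\<^sub>R x)"
    by (rule ext) (simp add: grad_m3[OF sym T] power2_norm_eq_inner)
  have deriv: "(grad (m3 f0 g H T \<sigma>) has_derivative (\<lambda>h.
    H *v h + tensor_apply T x h + (\<sigma> * norm x ^ 2) *\<^sub>R h + (2 * \<sigma> * (x \<bullet> h)) *\<^sub>R x)) (at x)"
    unfolding eq
    apply (rule has_derivative_eq_rhs)
     apply (rule derivative_eq_intros T_deriv H_deriv refl)+
    apply (rule ext)
    subgoal for h
      using tensor_apply_commute[OF T, of h x]
      by (simp add: inner_commute power2_norm_eq_inner algebra_simps flip: scaleR_add_left)
    done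
  then have "(grad (m3 f0 g H T \<sigma>) has_derivative (\<lambda>h. hess (m3 f0 g H T \<sigma>) x *v h)) (at x)"
    unfolding hess_def using jacobian_works differentiableI by blast
  from has_derivative_unique[OF this deriv] show ?thesis by metis
qed

lemma transpose_hess_m3:
  fixes g :: "real^'n"
  assumes sym: "transpose H = H" and T: "symmetric_tensor T"
  shows "transpose (hess (m3 f0 g H T \<sigma>) x) = hess (m3 f0 g H T \<sigma>) x"
  unfolding transpose_eq_self_iff hess_m3_mult[OF sym T] inner_add_right
proof (intro allI)
  fix u v
  show "u \<bullet> (H *v v) + u \<bullet> tensor_apply T x v + u \<bullet> (\<sigma> * (norm x)\<^sup>2) *\<^sub>R v + u \<bullet> (2 * \<sigma> * (x \<bullet> v)) *\<^sub>R x =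
    v \<bullet> (H *v u) + v \<bullet> tensor_apply T x u + v \<bullet> (\<sigma> * (norm x)\<^sup>2) *\<^sub>R u + v \<bullet> (2 * \<sigma> * (x \<bullet> u)) *\<^sub>R x"
    using symmetric_matrix_inner[OF sym, of u v] inner_tensor_apply_swap[OF T, of u x v]
      inner_tensor_apply_swap[OF T, of v x u] tensor_apply_commute[OF T, of u v]
    by (simp add: inner_commute)
qed

text \<open>The expansion ends at order 4 without remainder. The bracket after 1/6 is the third
  derivative at \<open>x\<close>, and the quartic term does not depend on \<open>x\<close>.\<close>

lemma m3_taylor:
  fixes g :: "real^'n" and f0 \<sigma> :: real
  assumes sym: "transpose H = H" and T: "symmetric_tensor T"
  defines "m \<equiv> m3 f0 g H T \<sigma>"
  shows "m (x + s) = m x + grad m x \<bullet> s + 1/2 * (s \<bullet> (hess m x *v s))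
    + 1/6 * (tensor_cube T s + 6 * \<sigma> * (x \<bullet> s) * norm s ^ 2) + \<sigma>/4 * norm s ^ 4"
proof -
  interpret bounded_bilinear "tensor_apply T" by (rule bounded_bilinear_tensor_apply)
  have "tensor_cube T (x + s) = tensor_cube T x + 3 * (s \<bullet> tensor_apply T x x)
      + 3 * (s \<bullet> tensor_apply T x s) + tensor_cube T s"
    using inner_tensor_apply_swap[OF T, of x s s] inner_tensor_apply_swap[OF T, of x s x]
    unfolding tensor_cube_eq add_left add_right inner_add_left inner_add_right
      tensor_apply_commute[OF T, of s x] by simp
  moreover have "norm (x + s) ^ 4 = norm x ^ 4 + 4 * (x \<bullet> s) * norm x ^ 2 + 4 * (x \<bullet> s)\<^sup>2
      + 2 * norm x ^ 2 * norm s ^ 2 + 4 * (x \<bullet> s) * norm s ^ 2 + norm s ^ 4"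
    unfolding norm_pow4_eq_inner power2_norm_eq_inner
    by (simp add: inner_add_left inner_add_right inner_commute power2_eq_square algebra_simps)
  moreover have "(x + s) \<bullet> (H *v (x + s)) = x \<bullet> (H *v x) + 2 * (s \<bullet> (H *v x)) + s \<bullet> (H *v s)"
    using symmetric_matrix_inner[OF sym, of x s]
    by (simp add: matrix_vector_right_distrib inner_add_left inner_add_right)
  ultimately show ?thesis
    unfolding m_def hess_m3_mult[OF sym T] grad_m3[OF sym T]
    by (simp add: m3_def inner_add_left inner_add_right inner_commute
        dot_square_norm power2_eq_square algebra_simps)
qed

text \<open>The parenthesized group collects what is quadratic in \<open>s\<close>; the cubic term
  after it has the same form as the gradient of the quartic term of the model.\<close>

lemma grad_m3_taylor:
  fixes g :: "real^'n" and f0 \<sigma> :: real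
  assumes sym: "transpose H = H" and T: "symmetric_tensor T"
  defines "m \<equiv> m3 f0 g H T \<sigma>"
  shows "grad m (x + s) = grad m x + hess m x *v s
    + ((1/2) *\<^sub>R tensor_apply T s s + (2 * \<sigma> * (x \<bullet> s)) *\<^sub>R s + (\<sigma> * norm s ^ 2) *\<^sub>R x)
    + (\<sigma> * norm s ^ 2) *\<^sub>R s"
proof -
  interpret bounded_bilinear "tensor_apply T" by (rule bounded_bilinear_tensor_apply)
  have *: "tensor_apply T (x + s) (x + s) = tensor_apply T x x + 2 *\<^sub>R tensor_apply T x s + tensor_apply T s s"
    using tensor_apply_commute[OF T, of x s]
    by (simp add: add_left add_right scaleR_2)
  have "norm (x + s) ^ 2 = norm x ^ 2 + 2 * (x \<bullet> s) + norm s ^ 2"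
    by (simp add: power2_norm_eq_inner inner_add_left inner_add_right inner_commute)
  then show ?thesis
    unfolding m_def hess_m3_mult[OF sym T] grad_m3[OF sym T] *
    by (simp add: matrix_vector_right_distrib scaleR_add_left scaleR_add_right distrib_left
        mult_ac)
qed

section \<open>Minimizers of the quadratic-quartic model\<close>

text \<open>With zero tensor, \<open>m3\<close> has the shape of the quadratic-quartic model, so the
  calculus of \<open>m3\<close> serves for the model too.\<close>

lemma hess_m3_zero_tensor_inner:
  assumes sym: "transpose A = A"
  shows "w \<bullet> (hess (m3 f g A 0 c) s *v w) =
    w \<bullet> (A *v w) + c * norm s ^ 2 * norm w ^ 2 + 2 * c * (s \<bullet> w)\<^sup>2"
proof -
  have T: "symmetric_tensor 0" by (simp add: symmetric_tensor_def)
  have "tensor_apply 0 s w = 0" by (simp add: tensor_apply_def vec_eq_iff)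
  then show ?thesis
    by (simp add: hess_m3_mult[OF sym T] inner_add_right inner_commute dot_square_norm
        power2_eq_square)
qed

text \<open>Global optimality conditions. Semidefiniteness holds for all \<open>v\<close>, not only
  in the form of the weaker second-order condition on the Hessian: finite displacements along
  \<open>v\<close> are chosen for which the quartic contribution vanishes or stays small.\<close>

lemma
  fixes g :: "real^'n"
  assumes sym: "transpose A = A" and "c > 0"
    and min: "is_arg_min (m3 f g A 0 c) (\<lambda>_. True) s"
  shows quartic_minimizer_stationary: "g + A *v s + (c * norm s ^ 2) *\<^sub>R s = 0"
    and quartic_minimizer_psd: "0 \<le> v \<bullet> (A *v v) + c * norm s ^ 2 * norm v ^ 2"
proof -
  have T: "symmetric_tensor 0" by (simp add: symmetric_tensor_def)
  define q where "q = m3 f g A 0 c"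
  have le: "q s \<le> q y" for y
    using min unfolding is_arg_min_def q_def by (meson not_le)
  have "GDERIV q s :> grad q s"
    unfolding q_def grad_m3[OF sym T] by (rule GDERIV_m3[OF sym T])
  then have "(\<lambda>h. h \<bullet> grad q s) = (\<lambda>h. 0)"
    unfolding gderiv_def
    by (rule differential_zero_maxmin[OF UNIV_I open_UNIV]) (use le in auto)
  then have grad0: "grad q s = 0" by (metis inner_eq_zero_iff)
  moreover have "tensor_apply 0 s s = 0" by (simp add: tensor_apply_def vec_eq_iff)
  ultimately show "g + A *v s + (c * norm s ^ 2) *\<^sub>R s = 0"
    by (simp add: q_def grad_m3[OF sym T])
  define Q where "Q v = v \<bullet> (A *v v) + c * norm s ^ 2 * norm v ^ 2" for v
  have Q: "0 \<le> Q w / 2 + c * (s \<bullet> w + norm w ^ 2 / 2)\<^sup>2" for w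
  proof -
    \<comment> \<open>Substituting \<open>norm (s + w) ^ 2 = norm s ^ 2 + 2 * (s \<bullet> w + norm
      w ^ 2 / 2)\<close> into the quartic term produces the square; stationarity removes the linear
      part.\<close>
    have "q (s + w) = q s + (Q w / 2 + c * (s \<bullet> w + norm w ^ 2 / 2)\<^sup>2)"
      using m3_taylor[OF sym T, of f g c s w] grad0
      unfolding q_def[symmetric]
      by (simp add: q_def hess_m3_zero_tensor_inner[OF sym] Q_def tensor_cube_def)
        (simp add: power2_eq_square power4_eq_xxxx algebra_simps)
    with le[of "s + w"] show ?thesis by simp
  qed
  have Q_scale: "Q (t *\<^sub>R v) = t\<^sup>2 * Q v" for t
    by (simp add: Q_def matrix_vector_mult_scaleR power_mult_distrib algebra_simps power2_eq_square)
  have "0 \<le> Q v"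
  proof (cases "s \<bullet> v = 0")
    case True
    show ?thesis
    proof (rule ccontr)
      assume neg: "\<not> 0 \<le> Q v"
      then have "v \<noteq> 0" by (auto simp: Q_def)
      \<comment> \<open>For \<open>v\<close> orthogonal to \<open>s\<close>, this \<open>t\<close>
        makes the square term exactly half as large as the negative term
        \<open>t^2 * Q v / 2\<close>, so the sum stays negative.\<close>
      define t where "t = sqrt (- Q v / (c * norm v ^ 4))"
      have t2: "t\<^sup>2 = - Q v / (c * norm v ^ 4)"
        using neg \<open>c > 0\<close> by (simp add: t_def divide_nonpos_nonneg)
      then have "t\<^sup>2 > 0" using neg \<open>c > 0\<close> \<open>v \<noteq> 0\<close> by (simp add: divide_neg_pos)
      have "0 \<le> t\<^sup>2 * Q v / 2 + c * (t\<^sup>2 * norm v ^ 2 / 2)\<^sup>2"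
        using Q[of "t *\<^sub>R v"] True by (simp add: Q_scale power_mult_distrib)
      also have "c * (t\<^sup>2 * norm v ^ 2 / 2)\<^sup>2 = t\<^sup>2 * (t\<^sup>2 * (c * norm v ^ 4)) / 4"
        by (simp add: power2_eq_square power4_eq_xxxx)
      also have "t\<^sup>2 * (c * norm v ^ 4) = - Q v"
        using t2 \<open>v \<noteq> 0\<close> \<open>c > 0\<close> by simp
      finally have "0 \<le> t\<^sup>2 * Q v" by (simp add: mult.commute)
      with \<open>t\<^sup>2 > 0\<close> neg show False by (simp add: zero_le_mult_iff)
    qed
  next
    case False
    then have "v \<noteq> 0" by auto
    \<comment> \<open>The reflected point has the same norm as \<open>s\<close>, so the quartic part of the model does
      not change.\<close>
    define t where "t = - 2 * (s \<bullet> v) / norm v ^ 2"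
    have "t \<noteq> 0" using False \<open>v \<noteq> 0\<close> by (simp add: t_def)
    have "s \<bullet> (t *\<^sub>R v) + norm (t *\<^sub>R v) ^ 2 / 2 = 0"
      using \<open>v \<noteq> 0\<close> by (simp add: t_def power_mult_distrib power2_eq_square field_simps)
    with Q[of "t *\<^sub>R v"] have "0 \<le> t\<^sup>2 * Q v" by (simp add: Q_scale)
    with \<open>t \<noteq> 0\<close> show ?thesis by (simp add: zero_le_mult_iff)
  qed
  then show "0 \<le> v \<bullet> (A *v v) + c * norm s ^ 2 * norm v ^ 2" by (simp add: Q_def)
qed

section \<open>Uniform bounds on the sublevel set of the starting point\<close>

text \<open>Homogeneity of degree 3 reduces this to the unit sphere, where the bilinear bound shows
  that the supremum is over a bounded set.\<close>

lemma tensor_cube_le_Lambda0: "tensor_cube T s \<le> Lambda0 T * norm s ^ 3"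
proof (cases "s = 0")
  case True
  then show ?thesis by (simp add: tensor_cube_def)
next
  case False
  interpret bounded_bilinear "tensor_apply T" by (rule bounded_bilinear_tensor_apply)
  obtain K where K: "\<And>a b. norm (tensor_apply T a b) \<le> norm a * norm b * K"
    using bounded by blast
  have "tensor_cube T u \<le> K" if "u \<in> sphere 0 1" for u
    using norm_cauchy_schwarz[of u "tensor_apply T u u"] K[of u u] that
    by (simp add: tensor_cube_eq)
  then have "bdd_above (tensor_cube T ` sphere 0 1)" by (auto intro!: bdd_aboveI)
  then have "tensor_cube T (sgn s) \<le> Lambda0 T"
    unfolding Lambda0_def using False by (intro cSUP_upper) (auto simp: norm_sgn)
  moreover have "tensor_cube T s = norm s ^ 3 * tensor_cube T (sgn s)"
    using False by (simp add: sgn_div_norm flip: tensor_cube_scaleR)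
  ultimately show ?thesis
    by (simp add: mult.commute mult_right_mono)
qed

text \<open>The cubic form is odd, so it is nonnegative at \<open>u\<close> or at
  \<open>-u\<close>.\<close>

lemma Lambda0_nonneg: "0 \<le> Lambda0 (T :: real^'n^'n^'n)"
proof -
  obtain u :: "real^'n" where "norm u = 1" using vector_choose_size[of 1] by auto
  then show ?thesis
    using tensor_cube_le_Lambda0[of T u] tensor_cube_le_Lambda0[of T "-u"]
      tensor_cube_scaleR[of T "-1" u] by simp
qed

lemma lambda0_le_quadratic:
  assumes "transpose H = H"
  shows "- lambda0 H * norm s ^ 2 \<le> s \<bullet> (H *v s)"
proof -
  have "- lambda0 H * norm s ^ 2 \<le> lambda_min H * norm s ^ 2"
    unfolding lambda0_def by (intro mult_right_mono) auto
  with lambda_min_le_quadratic[OF assms, of s] show ?thesis by linarith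
qed

section \<open>The radius \<open>rc\<close> and the ball that contains the sublevel set\<close>

definition rc_rhs :: "real^'n \<Rightarrow> real^'n^'n \<Rightarrow> real^'n^'n^'n \<Rightarrow> real \<Rightarrow> real" where
  "rc_rhs g H T r = norm g / r^3 + lambda0 H / (2 * r^2) + Lambda0 T / (6 * r)"

text \<open>Strictness comes from the term with \<open>norm g\<close>, since
  \<open>lambda0 H\<close> and \<open>Lambda0 T\<close> may vanish.\<close>

lemma rc_rhs_strict_antimono:
  assumes "g \<noteq> 0" "0 < r" "r < u"
  shows "rc_rhs g H T u < rc_rhs g H T r"
  unfolding rc_rhs_def
proof (intro add_less_le_mono)
  have "r ^ 3 < u ^ 3" using assms by (simp add: power_strict_mono)
  then show "norm g / u ^ 3 < norm g / r ^ 3"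
    using assms by (intro divide_strict_left_mono mult_pos_pos) auto
  have "r\<^sup>2 \<le> u\<^sup>2" using assms by (simp add: power_mono)
  then show "lambda0 H / (2 * u\<^sup>2) \<le> lambda0 H / (2 * r\<^sup>2)"
    using assms by (intro divide_left_mono mult_pos_pos) (auto simp: lambda0_def)
  show "Lambda0 T / (6 * u) \<le> Lambda0 T / (6 * r)"
    using assms by (intro divide_left_mono mult_pos_pos) (auto simp: Lambda0_nonneg)
qed

text \<open>Existence follows from the intermediate value theorem, uniqueness from strict
  monotonicity; together they give \<open>THE\<close> in \<open>rc\<close> its meaning.\<close>

lemma
  assumes "g \<noteq> 0" "\<sigma> > 0"
  shows rc_pos: "rc g H T \<sigma> > 0"
    and rc_eq: "\<sigma> = 4 * rc_rhs g H T (rc g H T \<sigma>)"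
proof -
  \<comment> \<open>The defining equation multiplied by \<open>r^3\<close>, which is continuous at 0
    too.\<close>
  define P where "P r = \<sigma> * r^3 - 4 * norm g - 2 * lambda0 H * r - 2/3 * Lambda0 T * r^2" for r
  have P_iff: "\<sigma> = 4 * rc_rhs g H T r \<longleftrightarrow> P r = 0" if "r > 0" for r
    using that by (auto simp: P_def rc_rhs_def field_simps power2_eq_square power3_eq_cube)
  have nn: "norm g \<ge> 0" "lambda0 H \<ge> 0" "Lambda0 T \<ge> 0"
    by (auto simp: lambda0_def Lambda0_nonneg)
  define S where "S = 4 * norm g + 2 * lambda0 H + Lambda0 T"
  \<comment> \<open>As \<open>R \<ge> 1\<close>, the subtracted terms of \<open>P R\<close> are
    together at most \<open>S * R^2\<close>, and \<open>\<sigma> * R = \<sigma> + S\<close> makes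
    the cubic term dominate them.\<close>
  define R where "R = 1 + S / \<sigma>"
  have "S \<ge> 0" using nn by (simp add: S_def)
  then have "R \<ge> 1" using assms by (simp add: R_def)
  have "S * R\<^sup>2 \<le> (\<sigma> * R) * R\<^sup>2"
    using assms \<open>R \<ge> 1\<close> by (intro mult_right_mono) (auto simp: R_def distrib_left)
  moreover have "4 * norm g * 1 \<le> 4 * norm g * R\<^sup>2"
    using \<open>R \<ge> 1\<close> nn by (intro mult_left_mono) auto
  moreover have "2 * lambda0 H * R \<le> 2 * lambda0 H * R\<^sup>2"
    using \<open>R \<ge> 1\<close> nn by (intro mult_left_mono) (auto simp: power2_eq_square)
  moreover have "2/3 * Lambda0 T * R\<^sup>2 \<le> Lambda0 T * R\<^sup>2"
    using nn by (intro mult_right_mono) auto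
  ultimately have "P R \<ge> 0"
    by (simp add: P_def S_def power3_eq_cube power2_eq_square algebra_simps)
  moreover have "P 0 < 0" using assms by (simp add: P_def)
  moreover have "continuous_on {0..R} P"
    unfolding P_def by (intro continuous_intros)
  ultimately obtain r where "0 \<le> r" "P r = 0"
    using IVT'[of P 0 0 R] \<open>R \<ge> 1\<close> by auto
  with \<open>P 0 < 0\<close> have r: "r > 0" "\<sigma> = 4 * rc_rhs g H T r"
    using P_iff[of r] by (cases "r = 0", auto)+
  have "u = r" if "u > 0" "\<sigma> = 4 * rc_rhs g H T u" for u
    using rc_rhs_strict_antimono[OF assms(1), of r u H T]
      rc_rhs_strict_antimono[OF assms(1), of u r H T] that r
    by (cases u r rule: linorder_cases) auto
  then have "rc g H T \<sigma> = r"
    unfolding rc_def rc_rhs_def[symmetric] using r by (intro the_equality) auto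
  with r show "rc g H T \<sigma> > 0" "\<sigma> = 4 * rc_rhs g H T (rc g H T \<sigma>)" by simp_all
qed

text \<open>At radius \<open>rc\<close> the quartic term balances the worst case of the linear,
  quadratic and cubic terms; beyond it \<open>m3\<close> exceeds its value \<open>f0\<close> at the
  origin.\<close>

lemma norm_le_rc:
  assumes "g \<noteq> 0" "\<sigma> > 0" "transpose H = H" "m3 f0 g H T \<sigma> s \<le> f0"
  shows "norm s \<le> rc g H T \<sigma>"
proof (rule ccontr)
  define u where "u = norm s"
  assume "\<not> norm s \<le> rc g H T \<sigma>"
  then have "u > rc g H T \<sigma>" by (simp add: u_def)
  then have "u > 0" using rc_pos[OF assms(1,2), of H T] by linarith
  have "4 * rc_rhs g H T u < \<sigma>"
    using rc_rhs_strict_antimono[OF assms(1) rc_pos[OF assms(1,2)] \<open>rc g H T \<sigma> < u\<close>, of H T]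
      rc_eq[OF assms(1,2), of H T] by linarith
  with \<open>u > 0\<close> have "u ^ 4 * (4 * rc_rhs g H T u) < u ^ 4 * \<sigma>" by simp
  moreover have "u ^ 4 * (4 * rc_rhs g H T u)
      = 4 * (norm g * u + lambda0 H / 2 * u^2 + Lambda0 T / 6 * u ^ 3)"
    using \<open>u > 0\<close>
    by (simp add: rc_rhs_def field_simps power2_eq_square power3_eq_cube power4_eq_xxxx)
  moreover have "- (norm g * u) \<le> g \<bullet> s"
    using norm_cauchy_schwarz[of "-g" s] by (simp add: u_def)
  moreover have "- (Lambda0 T * u ^ 3) \<le> tensor_cube T s"
    using tensor_cube_le_Lambda0[of T "-s"] tensor_cube_scaleR[of T "-1" s] by (simp add: u_def)
  moreover have "- lambda0 H * u ^ 2 \<le> s \<bullet> (H *v s)"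
    unfolding u_def by (rule lambda0_le_quadratic[OF assms(3)])
  ultimately show False using assms(4) unfolding m3_def u_def[symmetric]
    by (simp add: algebra_simps)
qed

lemma LH_pos:
  assumes "g \<noteq> 0" "\<sigma> > 0"
  shows "LH g H T \<sigma> > 0"
  using rc_pos[OF assms] Lambda0_nonneg[of T] assms(2) by (simp add: LH_def add_nonneg_pos)

text \<open>The two summands of \<open>LH\<close> bound the tensor part and the quartic part of the
  third derivative on the ball of radius \<open>rc\<close>.\<close>

lemma third_derivative_le_LH:
  assumes "\<sigma> > 0" "norm x \<le> rc g H T \<sigma>"
  shows "tensor_cube T s + 6 * \<sigma> * (x \<bullet> s) * norm s ^ 2 \<le> LH g H T \<sigma> * norm s ^ 3"
proof -
  have "x \<bullet> s \<le> rc g H T \<sigma> * norm s"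
    using norm_cauchy_schwarz[of x s] mult_right_mono[OF assms(2), of "norm s"] by simp
  then have "6 * \<sigma> * (x \<bullet> s) * norm s ^ 2 \<le> 6 * \<sigma> * (rc g H T \<sigma> * norm s) * norm s ^ 2"
    using assms(1) by (intro mult_right_mono mult_left_mono) auto
  with tensor_cube_le_Lambda0[of T s] show ?thesis
    by (simp add: LH_def algebra_simps power2_eq_square power3_eq_cube)
qed

text \<open>The four terms of \<open>hess_m3_mult\<close> are bounded separately, uniformly in
  \<open>x\<close>; the final \<open>+ 1\<close> in \<open>B\<close> secures strict
  positivity.\<close>

lemma hess_m3_bounded_on_cball:
  fixes g :: "real^'n" and H :: "real^'n^'n"
  assumes "transpose H = H" "symmetric_tensor T" "\<sigma> > 0"
  obtains B where "B > 0"
    "\<And>x v. norm x \<le> r \<Longrightarrow> norm (hess (m3 f0 g H T \<sigma>) x *v v) \<le> B * norm v"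
proof -
  obtain K where K: "K \<ge> 0" "\<And>a b. norm (tensor_apply T a b) \<le> norm a * norm b * K"
    using bounded_bilinear.nonneg_bounded[OF bounded_bilinear_tensor_apply] by blast
  obtain N where N: "\<And>v. norm (H *v v) \<le> norm v * N"
    using bounded_linear.bounded[OF matrix_vector_mul_bounded_linear[of H]] by blast
  define B where "B = \<bar>N\<bar> + \<bar>r\<bar> * K + \<sigma> * r^2 + 2 * \<sigma> * r^2 + 1"
  show ?thesis
  proof
    show "B > 0" using K(1) assms(3) by (simp add: B_def add_nonneg_pos)
    fix x v :: "real^'n"
    assume x: "norm x \<le> r"
    have "norm (H *v v) \<le> \<bar>N\<bar> * norm v"
      using N[of v] mult_right_mono[OF abs_ge_self[of N], of "norm v"] by (simp add: mult.commute)
    moreover have "norm (tensor_apply T x v) \<le> \<bar>r\<bar> * K * norm v"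
      using K(2)[of x v] mult_right_mono[of "norm x" "\<bar>r\<bar>" "norm v * K"] x K(1)
        abs_ge_self[of r]
      by (simp add: mult_ac)
    moreover have x2: "norm x ^ 2 \<le> r ^ 2" using x by (simp add: power_mono)
    then have "norm ((\<sigma> * norm x ^ 2) *\<^sub>R v) \<le> \<sigma> * r^2 * norm v"
      using assms(3) by (simp add: mult_right_mono)
    moreover have "norm ((2 * \<sigma> * (x \<bullet> v)) *\<^sub>R x) \<le> 2 * \<sigma> * r^2 * norm v"
    proof -
      have "\<bar>x \<bullet> v\<bar> * norm x \<le> (norm x * norm v) * norm x"
        by (intro mult_right_mono Cauchy_Schwarz_ineq2) simp
      also have "\<dots> \<le> r^2 * norm v"
        using mult_right_mono[OF x2, of "norm v"] by (simp add: power2_eq_square mult_ac)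
      finally show ?thesis using assms(3) by (simp add: abs_mult mult.assoc)
    qed
    moreover have "norm (hess (m3 f0 g H T \<sigma>) x *v v) \<le> norm (H *v v) + norm (tensor_apply T x v)
        + norm ((\<sigma> * norm x ^ 2) *\<^sub>R v) + norm ((2 * \<sigma> * (x \<bullet> v)) *\<^sub>R x)"
      unfolding hess_m3_mult[OF assms(1,2)]
      by (intro norm_triangle_mono order_refl)
    ultimately show "norm (hess (m3 f0 g H T \<sigma>) x *v v) \<le> B * norm v"
      by (simp add: B_def algebra_simps add_increasing)
  qed
qed

text \<open>Subtracting the cubic term exactly leaves the quadratic group of
  \<open>grad_m3_taylor\<close>, so the bound holds for steps of any length.\<close>

lemma grad_m3_taylor_bounded_on_cball:
  fixes g :: "real^'n" and H :: "real^'n^'n"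
  assumes "transpose H = H" "symmetric_tensor T" "\<sigma> > 0"
  obtains K where "K > 0"
    "\<And>x s. norm x \<le> r \<Longrightarrow> norm (grad (m3 f0 g H T \<sigma>) (x + s) - grad (m3 f0 g H T \<sigma>) x
      - hess (m3 f0 g H T \<sigma>) x *v s - (\<sigma> * norm s ^ 2) *\<^sub>R s) \<le> K * norm s ^ 2"
proof -
  obtain K where K: "K \<ge> 0" "\<And>a b. norm (tensor_apply T a b) \<le> norm a * norm b * K"
    using bounded_bilinear.nonneg_bounded[OF bounded_bilinear_tensor_apply] by blast
  define C where "C = K / 2 + 2 * \<sigma> * \<bar>r\<bar> + \<sigma> * \<bar>r\<bar> + 1"
  show ?thesis
  proof
    show "C > 0" using K(1) assms(3) by (simp add: C_def add_nonneg_pos)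
    fix x s :: "real^'n"
    assume x: "norm x \<le> r"
    have "norm ((1/2) *\<^sub>R tensor_apply T s s) \<le> K / 2 * norm s ^ 2"
      using K(2)[of s s] by (simp add: power2_eq_square mult_ac)
    moreover have "norm ((2 * \<sigma> * (x \<bullet> s)) *\<^sub>R s) \<le> 2 * \<sigma> * \<bar>r\<bar> * norm s ^ 2"
    proof -
      have "\<bar>x \<bullet> s\<bar> * norm s \<le> (norm x * norm s) * norm s"
        by (intro mult_right_mono Cauchy_Schwarz_ineq2) simp
      also have "\<dots> \<le> \<bar>r\<bar> * norm s ^ 2"
        using mult_right_mono[of "norm x" "\<bar>r\<bar>" "norm s ^ 2"] x
        by (simp add: power2_eq_square mult_ac)
      finally show ?thesis using assms(3) by (simp add: abs_mult mult.assoc)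
    qed
    moreover have "norm ((\<sigma> * norm s ^ 2) *\<^sub>R x) \<le> \<sigma> * \<bar>r\<bar> * norm s ^ 2"
      using assms(3) x mult_left_mono[of "norm x" "\<bar>r\<bar>" "\<sigma> * norm s ^ 2"]
      by (simp add: mult_ac)
    moreover have "norm ((1/2) *\<^sub>R tensor_apply T s s + (2 * \<sigma> * (x \<bullet> s)) *\<^sub>R s + (\<sigma> * norm s ^ 2) *\<^sub>R x)
      \<le> norm ((1/2) *\<^sub>R tensor_apply T s s) + norm ((2 * \<sigma> * (x \<bullet> s)) *\<^sub>R s) + norm ((\<sigma> * norm s ^ 2) *\<^sub>R x)"
      by (intro norm_triangle_mono order_refl)
    ultimately have "norm ((1/2) *\<^sub>R tensor_apply T s s + (2 * \<sigma> * (x \<bullet> s)) *\<^sub>R s + (\<sigma> * norm s ^ 2) *\<^sub>R x)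
      \<le> C * norm s ^ 2"
      by (simp add: C_def distrib_right add_increasing2)
    then show "norm (grad (m3 f0 g H T \<sigma>) (x + s) - grad (m3 f0 g H T \<sigma>) x
      - hess (m3 f0 g H T \<sigma>) x *v s - (\<sigma> * norm s ^ 2) *\<^sub>R s) \<le> C * norm s ^ 2"
      unfolding grad_m3_taylor[OF assms(1,2), of f0 g \<sigma> x s] by (simp add: algebra_simps)
  qed
qed

section \<open>Steps of the method\<close>

text \<open>Up to the factor \<open>n^2\<close> this is a quadratic polynomial in \<open>n\<close>
  with nonpositive discriminant. It absorbs the cubic Taylor term, and the lower bounds on
  \<open>d\<close> supply the discriminant condition.\<close>

lemma cubic_le_quadratic_quartic:
  fixes A D n :: real
  assumes "A > 0" "n \<ge> 0" "(c/6)\<^sup>2 \<le> 4 * A * D"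
  shows "c/6 * n^3 \<le> A * n\<^sup>2 + D * n^4"
proof -
  have "0 \<le> (2 * A - c/6 * n)\<^sup>2 + (4 * A * D - (c/6)\<^sup>2) * n\<^sup>2"
    using assms by (intro add_nonneg_nonneg mult_nonneg_nonneg) auto
  also have "\<dots> = 4 * A * (A - c/6 * n + D * n\<^sup>2)"
    by (simp add: power2_eq_square algebra_simps)
  finally have "0 \<le> A - c/6 * n + D * n\<^sup>2"
    using assms(1) by (simp add: zero_le_mult_iff)
  then have "0 \<le> n\<^sup>2 * (A - c/6 * n + D * n\<^sup>2)" by simp
  then show ?thesis
    by (simp add: algebra_simps power2_eq_square power3_eq_cube power4_eq_xxxx)
qed

lemma quad_quartic_model_eq_m3:
  "quad_quartic_model \<sigma> m \<alpha>1 \<alpha>2 p x =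
     m3 (m x) (grad m x) (\<alpha>1 *\<^sub>R (hess m x + p *\<^sub>R mat 1)) 0 (\<sigma> * \<alpha>2)"
  by (rule ext) (simp add: quad_quartic_model_def m3_def tensor_cube_def
      scaleR_matrix_vector_assoc[symmetric])

text \<open>The case \<open>g \<noteq> 0\<close>, in which \<open>rc\<close> solves its equation;
  for \<open>g = 0\<close> the method is already stationary at the origin.\<close>

locale qqr_problem =
  fixes f0 \<sigma> \<eta> \<kappa> :: real
    and g :: "real^'n" and H :: "real^'n^'n" and T :: "real^'n^'n^'n"
  assumes H_sym: "transpose H = H" and T_sym: "symmetric_tensor T" and sigma_pos: "\<sigma> > 0"
    and eta_pos: "0 < \<eta>" and eta_less: "\<eta> < 1/3" and kappa_gt_1: "\<kappa> > 1"
    and g_nonzero: "g \<noteq> 0"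
begin

abbreviation m where "m \<equiv> m3 f0 g H T \<sigma>"
abbreviation L where "L \<equiv> LH g H T \<sigma>"
abbreviation R where "R \<equiv> rc g H T \<sigma>"

lemmas L_pos = LH_pos[OF g_nonzero sigma_pos, of H T]

lemma m_upper:
  assumes "norm x \<le> R"
  shows "m (x + s) \<le> m x + grad m x \<bullet> s + 1/2 * (s \<bullet> (hess m x *v s))
    + L/6 * norm s ^ 3 + \<sigma>/4 * norm s ^ 4"
  using third_derivative_le_LH[OF sigma_pos assms, of s]
  unfolding m3_taylor[OF H_sym T_sym, of f0 g \<sigma> x s] by simp

section \<open>Consequences of global minimality for one step\<close>

context
  fixes \<alpha>1 \<alpha>2 p x s
  assumes minimizer: "is_arg_min (quad_quartic_model \<sigma> m \<alpha>1 \<alpha>2 p x) (\<lambda>_. True) s"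
    and alpha2_pos: "\<alpha>2 > 0"
begin

lemma model_matrix_sym:
  "transpose (\<alpha>1 *\<^sub>R (hess m x + p *\<^sub>R mat 1)) = \<alpha>1 *\<^sub>R (hess m x + p *\<^sub>R mat 1)"
  unfolding transpose_eq_self_iff
proof (intro allI)
  fix u v
  show "u \<bullet> ((\<alpha>1 *\<^sub>R (hess m x + p *\<^sub>R mat 1)) *v v) = v \<bullet> ((\<alpha>1 *\<^sub>R (hess m x + p *\<^sub>R mat 1)) *v u)"
    using symmetric_matrix_inner[OF transpose_hess_m3[OF H_sym T_sym], of u f0 g \<sigma> x v]
    by (simp add: scaleR_matrix_vector_assoc[symmetric]
        matrix_vector_mult_add_rdistrib inner_add_right inner_commute[of u v])
qed

lemma step_stationary:
  "grad m x + \<alpha>1 *\<^sub>R (hess m x *v s + p *\<^sub>R s) + (\<sigma> * \<alpha>2 * norm s ^ 2) *\<^sub>R s = 0"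
  using quartic_minimizer_stationary[OF model_matrix_sym _ minimizer[unfolded quad_quartic_model_eq_m3]]
    sigma_pos alpha2_pos
  by (simp add: scaleR_matrix_vector_assoc[symmetric] matrix_vector_mult_add_rdistrib)

lemma step_psd:
  "0 \<le> \<alpha>1 * (v \<bullet> (hess m x *v v) + p * norm v ^ 2) + \<sigma> * \<alpha>2 * norm s ^ 2 * norm v ^ 2"
  using quartic_minimizer_psd[OF model_matrix_sym _ minimizer[unfolded quad_quartic_model_eq_m3], of v]
    sigma_pos alpha2_pos
  by (simp add: scaleR_matrix_vector_assoc[symmetric] matrix_vector_mult_add_rdistrib
      inner_add_right power2_norm_eq_inner)

lemma grad_inner_step:
  "grad m x \<bullet> s = - \<alpha>1 * (s \<bullet> (hess m x *v s) + p * norm s ^ 2) - \<sigma> * \<alpha>2 * norm s ^ 4"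
proof -
  have eq: "grad m x = - (\<alpha>1 *\<^sub>R (hess m x *v s + p *\<^sub>R s) + (\<sigma> * \<alpha>2 * norm s ^ 2) *\<^sub>R s)"
    using step_stationary by (simp only: eq_neg_iff_add_eq_0 add.assoc)
  show ?thesis
    unfolding eq
    by (simp add: inner_add_right inner_diff_right inner_commute[of _ s] dot_square_norm
        distrib_left power2_eq_square power4_eq_xxxx)
qed

text \<open>Stationarity eliminates the gradient; the coefficient 3/4 is the 1 from the gradient
  term less the 1/4 of the model.\<close>

lemma model_decrease_eq:
  "m x - quad_quartic_model \<sigma> m \<alpha>1 \<alpha>2 p x s =
    \<alpha>1/2 * (s \<bullet> (hess m x *v s) + p * norm s ^ 2) + 3/4 * \<sigma> * \<alpha>2 * norm s ^ 4"
  unfolding quad_quartic_model_def grad_inner_step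
  by (simp add: scaleR_matrix_vector_assoc[symmetric] matrix_vector_mult_add_rdistrib
      inner_add_right dot_square_norm power2_eq_square algebra_simps)

text \<open>Semidefiniteness at \<open>s\<close> itself costs at most half of
  \<open>\<sigma> * \<alpha>2 * norm s ^ 4\<close>, leaving a quarter, however negative the
  curvature is.\<close>

lemma model_decrease_ge:
  "m x - quad_quartic_model \<sigma> m \<alpha>1 \<alpha>2 p x s \<ge> \<sigma>/4 * \<alpha>2 * norm s ^ 4"
  unfolding model_decrease_eq using step_psd[of s]
  by (simp add: power2_eq_square power4_eq_xxxx algebra_simps)

lemma model_decrease_pos:
  assumes "grad m x \<noteq> 0"
  shows "m x - quad_quartic_model \<sigma> m \<alpha>1 \<alpha>2 p x s > 0"
proof -
  have "s \<noteq> 0" using step_stationary assms by auto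
  then have "0 < \<sigma>/4 * \<alpha>2 * norm s ^ 4" using sigma_pos alpha2_pos by simp
  with model_decrease_ge show ?thesis by linarith
qed

text \<open>Substituting stationarity for \<open>grad m x\<close> leaves only the terms in which the
  model deviates from the Taylor expansion.\<close>

lemma grad_step_norm_le:
  assumes K: "norm (grad m (x + s) - grad m x - hess m x *v s - (\<sigma> * norm s ^ 2) *\<^sub>R s) \<le> K * norm s ^ 2"
  shows "norm (grad m (x + s) - ((1 - \<alpha>1) *\<^sub>R (hess m x *v s) - (\<alpha>1 * p) *\<^sub>R s
    - (\<sigma> * (\<alpha>2 - 1) * norm s ^ 2) *\<^sub>R s)) \<le> K * norm s ^ 2"
proof -
  have eq: "grad m x = - (\<alpha>1 *\<^sub>R (hess m x *v s + p *\<^sub>R s) + (\<sigma> * \<alpha>2 * norm s ^ 2) *\<^sub>R s)"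
    using step_stationary by (simp only: eq_neg_iff_add_eq_0 add.assoc)
  have residual: "grad m (x + s) - ((1 - \<alpha>1) *\<^sub>R (hess m x *v s) - (\<alpha>1 * p) *\<^sub>R s
      - (\<sigma> * (\<alpha>2 - 1) * norm s ^ 2) *\<^sub>R s)
    = grad m (x + s) - grad m x - hess m x *v s - (\<sigma> * norm s ^ 2) *\<^sub>R s"
    unfolding eq by (simp add: algebra_simps)
  show ?thesis unfolding residual by (rule K)
qed

text \<open>The surplus of the model is \<open>a/2\<close> times a form bounded below by
  \<open>l\<close>, plus a quartic term with \<open>d\<close>; together they absorb the cubic
  term.\<close>

lemma convex_model_majorizes:
  assumes "norm x \<le> R" "p = 0" "\<alpha>1 = 1 + a" "\<alpha>2 = 1 + d" "lambda_min (hess m x) \<ge> l" "l > 0"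
    "a * l > 0" "d > L^2 / (18 * a * l * \<sigma>)"
  shows "m (x + s) \<le> quad_quartic_model \<sigma> m \<alpha>1 \<alpha>2 p x s"
proof -
  have "a > 0" using assms by (simp add: zero_less_mult_iff)
  have "(L/6)\<^sup>2 \<le> 4 * (a * l / 2) * (\<sigma> * d / 4)"
    using assms sigma_pos \<open>a > 0\<close> by (simp add: field_simps power2_eq_square)
  then have "L/6 * norm s ^ 3 \<le> (a * l / 2) * norm s ^ 2 + (\<sigma> * d / 4) * norm s ^ 4"
    using assms by (intro cubic_le_quadratic_quartic) auto
  moreover have "a * (l * norm s ^ 2) \<le> a * (s \<bullet> (hess m x *v s))"
    using lambda_min_le_quadratic[OF transpose_hess_m3[OF H_sym T_sym], of f0 g \<sigma> x s] \<open>a > 0\<close>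
      mult_right_mono[OF assms(5), of "norm s ^ 2"] by (intro mult_left_mono) auto
  ultimately show ?thesis
    using m_upper[OF assms(1), of s] assms(2-4)
    by (simp add: quad_quartic_model_def algebra_simps add_divide_distrib diff_divide_distrib)
qed

text \<open>Here the regularization \<open>p\<close> supplies the quadratic surplus, whatever the
  sign of the curvature.\<close>

lemma regularized_model_majorizes:
  assumes "norm x \<le> R" "\<alpha>1 = 1" "\<alpha>2 = 1 + d" "p > 0" "d > L^2 / (18 * p * \<sigma>)"
  shows "m (x + s) \<le> quad_quartic_model \<sigma> m \<alpha>1 \<alpha>2 p x s"
proof -
  have "(L/6)\<^sup>2 \<le> 4 * (p / 2) * (\<sigma> * d / 4)"
    using assms sigma_pos by (simp add: field_simps power2_eq_square)
  then have "L/6 * norm s ^ 3 \<le> (p / 2) * norm s ^ 2 + (\<sigma> * d / 4) * norm s ^ 4"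
    using assms by (intro cubic_le_quadratic_quartic) auto
  then show ?thesis
    using m_upper[OF assms(1), of s] assms(2,3)
    by (simp add: quad_quartic_model_def matrix_vector_mult_add_rdistrib inner_add_right
        scaleR_matrix_vector_assoc[symmetric] power2_norm_eq_inner algebra_simps add_divide_distrib diff_divide_distrib)
qed

text \<open>Testing semidefiniteness on an eigenvector of \<open>lambda_min\<close> bounds the step
  length from below.\<close>

lemma nonconvex_step_size:
  assumes "p = 0" "2 / (3 * (1 - \<eta>)) \<le> \<alpha>1" "lambda_min (hess m x) \<le> - l" "l > 0"
  shows "2/3 \<le> \<alpha>1" "\<alpha>1 * l \<le> \<sigma> * \<alpha>2 * norm s ^ 2"
proof -
  have "2/3 \<le> 2 / (3 * (1 - \<eta>))" using eta_pos eta_less by (simp add: field_simps)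
  with assms(2) show alpha: "2/3 \<le> \<alpha>1" by linarith
  obtain v where v: "v \<noteq> 0" "hess m x *v v = lambda_min (hess m x) *\<^sub>R v"
    using lambda_min_eigenvalue[OF transpose_hess_m3[OF H_sym T_sym]] unfolding eigenvalues_def by blast
  have "0 \<le> (\<alpha>1 * lambda_min (hess m x) + \<sigma> * \<alpha>2 * norm s ^ 2) * norm v ^ 2"
    using step_psd[of v] v assms(1) by (simp add: power2_norm_eq_inner algebra_simps)
  then have "0 \<le> \<alpha>1 * lambda_min (hess m x) + \<sigma> * \<alpha>2 * norm s ^ 2"
    using v(1) by (simp add: zero_le_mult_iff)
  moreover have "\<alpha>1 * lambda_min (hess m x) \<le> \<alpha>1 * (- l)"
    using alpha assms(3) by (intro mult_left_mono) auto
  ultimately show "\<alpha>1 * l \<le> \<sigma> * \<alpha>2 * norm s ^ 2" by simp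
qed

lemma nonconvex_step_sufficient_decrease:
  assumes "norm x \<le> R" "p = 0" "2 / (3 * (1 - \<eta>)) \<le> \<alpha>1" "\<alpha>1 \<le> 1" "\<alpha>2 = (1 + d) / \<eta>"
    "lambda_min (hess m x) \<le> - l" "l > 0" "d > L^2 / (3 * \<sigma> * l)"
  shows "\<eta> * (m x - quad_quartic_model \<sigma> m \<alpha>1 \<alpha>2 p x s) \<le> m x - m (x + s)"
proof -
  define n where "n = norm s"
  define Q where "Q = s \<bullet> (hess m x *v s)"
  define c where "c = \<sigma> * \<alpha>2 * n\<^sup>2"
  note size = nonconvex_step_size[OF assms(2,3,6,7), folded n_def]
  have c_ge: "c \<ge> \<alpha>1 * l" using size(2) by (simp add: c_def)
  have psd: "0 \<le> \<alpha>1 * Q + c * n\<^sup>2"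
    using step_psd[of s] assms(2) by (simp add: c_def n_def Q_def)
  have "(2 - \<eta>) * \<alpha>1 \<ge> 1"
  proof -
    have "(2 - \<eta>) * (2/3) \<le> (2 - \<eta>) * \<alpha>1" using size(1) eta_less by (intro mult_left_mono) auto
    then show ?thesis using eta_less by simp
  qed
  \<comment> \<open>The coefficient of \<open>Q\<close> is nonpositive, so \<open>Q\<close> may be replaced by its lower
    bound \<open>- c * n\<^sup>2 / \<alpha>1\<close>.\<close>
  then have "(1 - (2 - \<eta>) * \<alpha>1) * (\<alpha>1 * Q + c * n\<^sup>2) \<le> 0"
    using psd by (simp add: mult_nonpos_nonneg)
  then have "\<alpha>1 * ((1 - (2 - \<eta>) * \<alpha>1) / 2 * Q - (1 - \<eta>) * (c * n\<^sup>2) + (1/3) * (l * n\<^sup>2)) \<le>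
      - (1 - \<eta> * \<alpha>1) / 2 * (c * n\<^sup>2) + (1/3) * (\<alpha>1 * (l * n\<^sup>2))"
    by (simp add: field_simps)
  \<comment> \<open>Since \<open>\<eta> * \<alpha>1 \<le> 1/3\<close>, the first coefficient is at
    least 1/3, and \<open>c \<ge> \<alpha>1 * l\<close> pays for the \<open>l * n^2 / 3\<close>
    reserved for the cubic term.\<close>
  also have "\<dots> \<le> 0"
  proof -
    have "\<eta> * \<alpha>1 \<le> (1/3) * 1" using eta_less eta_pos assms(4) size(1) by (intro mult_mono) auto
    then have "1/3 * (\<alpha>1 * l) \<le> (1 - \<eta> * \<alpha>1) / 2 * c"
      using c_ge assms(7) size(1) by (intro mult_mono) auto
    from mult_right_mono[OF this, of "n\<^sup>2"] show ?thesis by (simp add: algebra_simps add_divide_distrib diff_divide_distrib)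
  qed
  finally have main: "(1 - (2 - \<eta>) * \<alpha>1) / 2 * Q - (1 - \<eta>) * (c * n\<^sup>2) + (1/3) * (l * n\<^sup>2) \<le> 0"
    using size(1) by (simp add: mult_le_0_iff)
  have "(L/6)\<^sup>2 \<le> L\<^sup>2 / 9" by (simp add: power2_eq_square)
  also have "\<dots> \<le> 4 * (l / 3) * (\<sigma> * d / 4)"
    using assms(7,8) sigma_pos by (simp add: field_simps power2_eq_square)
  finally have "L/6 * n ^ 3 \<le> (l / 3) * n\<^sup>2 + (\<sigma> * d / 4) * n ^ 4"
    using assms(7) by (intro cubic_le_quadratic_quartic) (auto simp: n_def)
  with main have key: "(1 - (2 - \<eta>) * \<alpha>1) / 2 * Q - (1 - \<eta>) * (c * n\<^sup>2) + L/6 * n^3 - \<sigma> * d / 4 * n^4 \<le> 0"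
    by linarith
  have cn: "c * n\<^sup>2 = \<sigma> * \<alpha>2 * n ^ 4" by (simp add: c_def power2_eq_square power4_eq_xxxx)
  have G: "grad m x \<bullet> s = - \<alpha>1 * Q - c * n\<^sup>2"
    using grad_inner_step assms(2) unfolding cn by (simp add: Q_def n_def)
  \<comment> \<open>The factor \<open>1 / \<eta>\<close> in \<open>\<alpha>2\<close> is made for
    this: a quarter of \<open>\<sigma> * (1 + d) * n^4\<close> covers the quartic term of
    \<open>m\<close> and leaves \<open>\<sigma> * d / 4 * n^4\<close> for the cubic one.\<close>
  have "\<eta> * \<alpha>2 = 1 + d" using assms(5) eta_pos by simp
  then have eta_cn: "\<eta> * (c * n\<^sup>2) = \<sigma> * (1 + d) * n ^ 4"
    unfolding cn by (metis mult.assoc mult.left_commute)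
  have "m (x + s) - m x \<le> - \<alpha>1 * Q - c * n\<^sup>2 + 1/2 * Q + L/6 * n ^ 3 + \<sigma>/4 * n ^ 4"
    using m_upper[OF assms(1), of s] G by (simp add: n_def Q_def)
  moreover have "\<eta> * (m x - quad_quartic_model \<sigma> m \<alpha>1 \<alpha>2 p x s)
      = \<eta> * (\<alpha>1/2 * Q) + 3/4 * (\<sigma> * (1 + d) * n ^ 4)"
    unfolding model_decrease_eq eta_cn[symmetric] cn
    using assms(2) by (simp add: Q_def n_def distrib_left)
  ultimately show ?thesis
    using key eta_cn by (simp add: algebra_simps add_divide_distrib diff_divide_distrib)
qed

end

lemma model_at_0: "quad_quartic_model \<sigma> m \<alpha>1 \<alpha>2 p x 0 = m x"
  by (simp add: quad_quartic_model_def)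

section \<open>Monotonicity, confinement of the iterates and acceptance of steps\<close>

lemma qqr_step_nonincreasing:
  assumes "qqr_step \<kappa> \<sigma> L m \<epsilon> lc \<eta> x x'"
  shows "m x' \<le> m x"
proof -
  obtain \<alpha>1 \<alpha>2 p s where
    minimizer: "is_arg_min (quad_quartic_model \<sigma> m \<alpha>1 \<alpha>2 p x) (\<lambda>_. True) s"
    and x': "x' = (if decrease_ratio \<sigma> m \<alpha>1 \<alpha>2 p x s \<ge> \<eta> then x + s else x)"
    using assms unfolding qqr_step_def by blast
  define D where "D = m x - quad_quartic_model \<sigma> m \<alpha>1 \<alpha>2 p x s"
  have "D \<ge> 0"
    using minimizer model_at_0[of \<alpha>1 \<alpha>2 p x] unfolding is_arg_min_def D_def
    by (metis diff_ge_0_iff_ge not_le)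
  show ?thesis
  proof (cases "decrease_ratio \<sigma> m \<alpha>1 \<alpha>2 p x s \<ge> \<eta>")
    case True
    \<comment> \<open>This also excludes \<open>D = 0\<close>, where the quotient is 0 by convention
      and the step is rejected.\<close>
    then have "(m x - m (x + s)) / D > 0"
      using eta_pos by (simp add: decrease_ratio_def D_def)
    with \<open>D \<ge> 0\<close> have "m x - m (x + s) > 0" by (simp add: zero_less_divide_iff)
    with True x' show ?thesis by simp
  qed (simp add: x')
qed

text \<open>The values never exceed \<open>m 0 = f0\<close>. All iterates thus share one ball, which
  makes the later constants independent of \<open>i\<close>.\<close>

lemma qqr_sequence_norm_le:
  assumes "qqr_sequence \<kappa> \<sigma> L m \<epsilon> lc \<eta> s"
  shows "norm (s i) \<le> R"
proof -
  have "m (s i) \<le> f0"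
  proof (induction i)
    case 0
    then show ?case using assms by (simp add: qqr_sequence_def m3_def tensor_cube_def)
  next
    case (Suc i)
    have "m (s (Suc i)) \<le> m (s i)"
      using assms qqr_step_nonincreasing[of \<epsilon> lc "s i" "s (Suc i)"]
      unfolding qqr_sequence_def by (metis order_refl)
    with Suc show ?case by simp
  qed
  then show ?thesis by (rule norm_le_rc[OF g_nonzero sigma_pos H_sym])
qed

text \<open>The parameter rules force acceptance: majorization gives a ratio of at least 1 in the
  two cases other than the nonconvex one, where the ratio is at least \<open>\<eta>\<close>.\<close>

lemma qqr_stepE:
  assumes step: "qqr_step \<kappa> \<sigma> L m \<epsilon> lc \<eta> x x'" and x: "norm x \<le> R"
    and eps: "\<epsilon> > 0" and lc: "lc > 0" and grad: "norm (grad m x) > \<epsilon>"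
  obtains \<alpha>1 \<alpha>2 p s where
    "qqr_parameters \<kappa> \<sigma> L \<epsilon> lc \<eta> (grad m x) (hess m x) \<alpha>1 \<alpha>2 p"
    "is_arg_min (quad_quartic_model \<sigma> m \<alpha>1 \<alpha>2 p x) (\<lambda>_. True) s"
    "\<alpha>2 > 0" "x' = x + s"
    "\<eta> * (m x - quad_quartic_model \<sigma> m \<alpha>1 \<alpha>2 p x s) \<le> m x - m x'"
    "\<not> lambda_min (hess m x) \<le> - lc \<Longrightarrow> m x' \<le> quad_quartic_model \<sigma> m \<alpha>1 \<alpha>2 p x s"
proof -
  obtain \<alpha>1 \<alpha>2 p s where
    params: "qqr_parameters \<kappa> \<sigma> L \<epsilon> lc \<eta> (grad m x) (hess m x) \<alpha>1 \<alpha>2 p"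
    and minimizer: "is_arg_min (quad_quartic_model \<sigma> m \<alpha>1 \<alpha>2 p x) (\<lambda>_. True) s"
    and x': "x' = (if decrease_ratio \<sigma> m \<alpha>1 \<alpha>2 p x s \<ge> \<eta> then x + s else x)"
    using step unfolding qqr_step_def by blast
  define D where "D = m x - quad_quartic_model \<sigma> m \<alpha>1 \<alpha>2 p x s"
  have majorizes: "0 < \<alpha>2 \<and> m (x + s) \<le> quad_quartic_model \<sigma> m \<alpha>1 \<alpha>2 p x s"
    if not_neg: "\<not> lambda_min (hess m x) \<le> - lc"
  proof (cases "lambda_min (hess m x) \<ge> lc")
    case True
    then obtain a d where *: "p = 0" "\<alpha>1 = 1 + a" "sqrt \<epsilon> \<le> a * lc" "\<alpha>2 = 1 + d"
      "d > L^2 / (18 * a * lc * \<sigma>)"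
      using params unfolding qqr_parameters_def admissible_def by blast
    have "a * lc > 0" using *(3) eps by (smt (verit) real_sqrt_gt_zero)
    then have "0 \<le> L^2 / (18 * a * lc * \<sigma>)" using sigma_pos by simp
    with *(4,5) have pos: "\<alpha>2 > 0" by linarith
    show ?thesis
      using convex_model_majorizes[OF minimizer pos x *(1,2,4) True lc \<open>a * lc > 0\<close> *(5)] pos
      by simp
  next
    case False
    then have "\<bar>lambda_min (hess m x)\<bar> < lc" using not_neg by linarith
    then obtain d where *: "\<alpha>1 = 1" "sqrt \<epsilon> \<le> p" "\<alpha>2 = 1 + d" "d > L^2 / (18 * p * \<sigma>)"
      using params unfolding qqr_parameters_def admissible_def by blast
    have "p > 0" using *(2) eps by (smt (verit) real_sqrt_gt_zero)
    then have "0 \<le> L^2 / (18 * p * \<sigma>)" using sigma_pos by simp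
    with *(3,4) have pos: "\<alpha>2 > 0" by linarith
    show ?thesis
      using regularized_model_majorizes[OF minimizer pos x *(1,3) \<open>p > 0\<close> *(4)] pos by simp
  qed
  have sufficient: "0 < \<alpha>2 \<and> \<eta> * D \<le> m x - m (x + s)"
  proof (cases "lambda_min (hess m x) \<le> - lc")
    case True
    then obtain d where *: "p = 0" "2 / (3 * (1 - \<eta>)) \<le> \<alpha>1" "\<alpha>1 \<le> 1" "\<alpha>2 = (1 + d) / \<eta>"
      "d > L^2 / (3 * \<sigma> * lc)"
      using params unfolding qqr_parameters_def admissible_def by blast
    have "0 \<le> L^2 / (3 * \<sigma> * lc)" using sigma_pos lc by simp
    with *(5) have "d > 0" by linarith
    with *(4) have pos: "\<alpha>2 > 0" using eta_pos by simp
    show ?thesis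
      using nonconvex_step_sufficient_decrease[OF minimizer pos x *(1-4) True lc *(5)] pos
      by (simp add: D_def)
  next
    case False
    have "D \<ge> 0"
      using minimizer model_at_0[of \<alpha>1 \<alpha>2 p x] unfolding is_arg_min_def D_def
      by (metis diff_ge_0_iff_ge not_le)
    then have "\<eta> * D \<le> 1 * D" using eta_less by (intro mult_right_mono) auto
    with majorizes[OF False] show ?thesis by (simp add: D_def)
  qed
  have "grad m x \<noteq> 0" using grad eps by auto
  then have "D > 0"
    unfolding D_def by (rule model_decrease_pos[OF minimizer conjunct1[OF sufficient]])
  with sufficient have "decrease_ratio \<sigma> m \<alpha>1 \<alpha>2 p x s \<ge> \<eta>"
    by (simp add: decrease_ratio_def pos_le_divide_eq flip: D_def)
  then have "x' = x + s" by (simp add: x')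
  then show thesis
    using that[OF params minimizer] sufficient majorizes by (simp add: D_def)
qed

subsection \<open>The locally nonconvex case\<close>

text \<open>The step satisfies \<open>\<sigma> * \<alpha>2 * n^2 \<ge> 2/3 * lc\<close> while
  \<open>\<alpha>2\<close> is at most of order \<open>1 / lc\<close>, so
  \<open>\<sigma>/4 * \<alpha>2 * n^4\<close> is at least of order \<open>lc^3\<close>.\<close>

lemma nonconvex_decrease:
  obtains c where "c > 0"
    "\<And>\<epsilon> lc x x'. \<lbrakk>qqr_step \<kappa> \<sigma> L m \<epsilon> lc \<eta> x x'; norm x \<le> R; \<epsilon> > 0; 0 < lc; lc \<le> 1;
      norm (grad m x) > \<epsilon>; lambda_min (hess m x) \<le> - lc\<rbrakk> \<Longrightarrow> c * lc ^ 3 \<le> m x - m x'"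
proof -
  \<comment> \<open>An upper bound for \<open>\<alpha>2 * lc\<close>, using
    \<open>lc \<le> 1\<close> and the upper limit on \<open>d\<close>.\<close>
  define M where "M = (1 + \<kappa> * L\<^sup>2 / (3 * \<sigma>)) / \<eta>"
  have "M > 0" using eta_pos sigma_pos kappa_gt_1 by (simp add: M_def add_pos_nonneg)
  show thesis
  proof
    show "\<eta> / (9 * \<sigma> * M) > 0" using eta_pos sigma_pos \<open>M > 0\<close> by simp
    fix \<epsilon> lc x x'
    assume step: "qqr_step \<kappa> \<sigma> L m \<epsilon> lc \<eta> x x'" "norm x \<le> R" "\<epsilon> > 0" "0 < lc"
      and "lc \<le> 1" and grad: "norm (grad m x) > \<epsilon>" and neg: "lambda_min (hess m x) \<le> - lc"
    obtain \<alpha>1 \<alpha>2 p s where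
      params: "qqr_parameters \<kappa> \<sigma> L \<epsilon> lc \<eta> (grad m x) (hess m x) \<alpha>1 \<alpha>2 p"
      and minimizer: "is_arg_min (quad_quartic_model \<sigma> m \<alpha>1 \<alpha>2 p x) (\<lambda>_. True) s"
      and "\<alpha>2 > 0"
      and decrease: "\<eta> * (m x - quad_quartic_model \<sigma> m \<alpha>1 \<alpha>2 p x s) \<le> m x - m x'"
      using qqr_stepE[OF step grad] by metis
    from params neg obtain d where d: "p = 0" "2 / (3 * (1 - \<eta>)) \<le> \<alpha>1" "\<alpha>2 = (1 + d) / \<eta>"
      "d \<le> \<kappa> * (L^2 / (3 * \<sigma> * lc))"
      unfolding qqr_parameters_def admissible_def by blast
    define n where "n = norm s"
    have size: "2/3 \<le> \<alpha>1" "\<alpha>1 * lc \<le> \<sigma> * \<alpha>2 * n\<^sup>2"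
      using nonconvex_step_size[OF minimizer \<open>\<alpha>2 > 0\<close> d(1,2) neg \<open>0 < lc\<close>] by (auto simp: n_def)
    have "\<alpha>2 \<le> M / lc"
    proof -
      have "1 \<le> 1 / lc" using \<open>0 < lc\<close> \<open>lc \<le> 1\<close> by simp
      with d(4) have one_d: "1 + d \<le> (1 + \<kappa> * L\<^sup>2 / (3 * \<sigma>)) / lc"
        by (simp add: add_divide_distrib)
      then show ?thesis
        using divide_right_mono[OF one_d, of \<eta>] eta_pos unfolding d(3) M_def by (simp add: mult.commute)
    qed
    have "2/3 * lc \<le> \<alpha>1 * lc" using size(1) \<open>0 < lc\<close> by (intro mult_right_mono) auto
    with size(2) have "2/3 * lc \<le> \<sigma> * \<alpha>2 * n\<^sup>2" by linarith
    then have "(2/3 * lc)\<^sup>2 \<le> (\<sigma> * \<alpha>2 * n\<^sup>2)\<^sup>2" using \<open>0 < lc\<close> by (intro power_mono) auto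
    also have "\<dots> = 4 * (\<sigma> * \<alpha>2) * (\<sigma>/4 * \<alpha>2 * n ^ 4)"
      by (simp add: power2_eq_square power4_eq_xxxx)
    also have "\<dots> \<le> 4 * (\<sigma> * (M / lc)) * (\<sigma>/4 * \<alpha>2 * n ^ 4)"
      using \<open>\<alpha>2 \<le> M / lc\<close> sigma_pos \<open>\<alpha>2 > 0\<close> by (intro mult_right_mono mult_left_mono) auto
    finally have "lc ^ 3 / (9 * \<sigma> * M) \<le> \<sigma>/4 * \<alpha>2 * n ^ 4"
      using sigma_pos \<open>M > 0\<close> \<open>0 < lc\<close> by (simp add: field_simps power2_eq_square power3_eq_cube)
    also have "\<dots> \<le> m x - quad_quartic_model \<sigma> m \<alpha>1 \<alpha>2 p x s"
      unfolding n_def by (rule model_decrease_ge[OF minimizer \<open>\<alpha>2 > 0\<close>])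
    finally have "\<eta> * (lc ^ 3 / (9 * \<sigma> * M)) \<le> \<eta> * (m x - quad_quartic_model \<sigma> m \<alpha>1 \<alpha>2 p x s)"
      using eta_pos by (intro mult_left_mono) auto
    with decrease show "\<eta> / (9 * \<sigma> * M) * lc ^ 3 \<le> m x - m x'" by simp
  qed
qed

subsection \<open>The locally nearly convex case\<close>

text \<open>The threshold for the step length is \<open>c * p\<close>. Beyond it the quartic
  decrease is of order \<open>p^3\<close>; below it each term of the new gradient is of order
  \<open>p^2\<close>, hence at most of the order of the old gradient norm.\<close>

lemma nearly_convex_decrease:
  assumes "\<rho> > 0"
  obtains c where "c > 0"
    "\<And>\<epsilon> lc x x'. \<lbrakk>qqr_step \<kappa> \<sigma> L m \<epsilon> lc \<eta> x x'; norm x \<le> R; \<epsilon> > 0; 0 < lc;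
      norm (grad m x) > \<epsilon>; \<bar>lambda_min (hess m x)\<bar> < lc\<rbrakk>
      \<Longrightarrow> c * sqrt \<epsilon> ^ 3 \<le> m x - m x' \<or> norm (grad m x') \<le> \<rho> * norm (grad m x)"
proof -
  obtain K where "K > 0" and K: "\<And>x s. norm x \<le> R \<Longrightarrow>
      norm (grad m (x + s) - grad m x - hess m x *v s - (\<sigma> * norm s ^ 2) *\<^sub>R s) \<le> K * norm s ^ 2"
    using grad_m3_taylor_bounded_on_cball[OF H_sym T_sym sigma_pos, of R f0 g] by blast
  define D where "D = \<kappa> * L\<^sup>2 / 18"
  have "D > 0" using kappa_gt_1 L_pos by (simp add: D_def)
  \<comment> \<open>The three summands belong to the regularization, the Taylor remainder and the
    quartic term; \<open>c \<le> 1\<close> allows higher powers of \<open>c\<close> to be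
    dropped.\<close>
  define c where "c = min 1 (\<rho> / (1 + K + D))"
  have c: "0 < c" "c \<le> 1" "c \<le> \<rho> / (1 + K + D)"
    using assms \<open>K > 0\<close> \<open>D > 0\<close> by (auto simp: c_def)
  then have c_sum: "c * (1 + K + D) \<le> \<rho>"
    using \<open>K > 0\<close> \<open>D > 0\<close> by (simp add: pos_le_divide_eq)
  show thesis
  proof
    show "L\<^sup>2 / 72 * c ^ 4 > 0" using L_pos c(1) by simp
    fix \<epsilon> lc x x'
    assume step: "qqr_step \<kappa> \<sigma> L m \<epsilon> lc \<eta> x x'" "norm x \<le> R" "\<epsilon> > 0" "0 < lc"
      and grad: "norm (grad m x) > \<epsilon>" and near: "\<bar>lambda_min (hess m x)\<bar> < lc"
    obtain \<alpha>1 \<alpha>2 p s where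
      params: "qqr_parameters \<kappa> \<sigma> L \<epsilon> lc \<eta> (grad m x) (hess m x) \<alpha>1 \<alpha>2 p"
      and minimizer: "is_arg_min (quad_quartic_model \<sigma> m \<alpha>1 \<alpha>2 p x) (\<lambda>_. True) s"
      and "\<alpha>2 > 0" and x': "x' = x + s"
      and decrease: "\<not> lambda_min (hess m x) \<le> - lc \<Longrightarrow> m x' \<le> quad_quartic_model \<sigma> m \<alpha>1 \<alpha>2 p x s"
      using qqr_stepE[OF step grad] by metis
    from params near obtain d where d: "\<alpha>1 = 1" "sqrt \<epsilon> \<le> p" "p \<le> sqrt (norm (grad m x))"
      "\<alpha>2 = 1 + d" "L^2 / (18 * p * \<sigma>) < d" "d \<le> \<kappa> * (L^2 / (18 * p * \<sigma>))"
      unfolding qqr_parameters_def admissible_def by blast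
    define n where "n = norm s"
    define \<gamma> where "\<gamma> = norm (grad m x)"
    have "sqrt \<epsilon> > 0" using \<open>\<epsilon> > 0\<close> by simp
    with d(2) have "p > 0" by linarith
    have "p\<^sup>2 \<le> \<gamma>"
      using d(3) \<open>p > 0\<close> power_mono[of p "sqrt \<gamma>" 2] by (simp add: \<gamma>_def)
    have sd: "L\<^sup>2 / (18 * p) \<le> \<sigma> * d" "\<sigma> * d \<le> D / p"
      using d(5,6) \<open>p > 0\<close> sigma_pos by (auto simp: D_def field_simps)
    have "0 \<le> L\<^sup>2 / (18 * p)" using \<open>p > 0\<close> by simp
    with sd(1) have sd_nonneg: "0 \<le> \<sigma> * d" by linarith
    show "L\<^sup>2 / 72 * c ^ 4 * sqrt \<epsilon> ^ 3 \<le> m x - m x' \<or> norm (grad m x') \<le> \<rho> * norm (grad m x)"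
    proof (cases "c * p \<le> n")
      case True
      have "sqrt \<epsilon> ^ 3 \<le> p ^ 3" using d(2) \<open>sqrt \<epsilon> > 0\<close> by (intro power_mono) auto
      then have "L\<^sup>2 / 72 * c ^ 4 * sqrt \<epsilon> ^ 3 \<le> L\<^sup>2 / 72 * c ^ 4 * p ^ 3"
        using c by (intro mult_left_mono) auto
      also have "\<dots> = 1/4 * (L\<^sup>2 / (18 * p)) * (c * p) ^ 4"
        using \<open>p > 0\<close> by (simp add: field_simps power3_eq_cube power4_eq_xxxx)
      also have "\<dots> \<le> 1/4 * (\<sigma> * d) * n ^ 4"
        using sd(1) sd_nonneg True c \<open>p > 0\<close> by (intro mult_mono power_mono) auto
      also have "\<dots> \<le> \<sigma>/4 * \<alpha>2 * n ^ 4"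
        using sigma_pos unfolding d(4) by (simp add: algebra_simps n_def)
      also have "\<dots> \<le> m x - quad_quartic_model \<sigma> m \<alpha>1 \<alpha>2 p x s"
        unfolding n_def by (rule model_decrease_ge[OF minimizer \<open>\<alpha>2 > 0\<close>])
      also have "\<dots> \<le> m x - m x'" using decrease near by linarith
      finally show ?thesis by simp
    next
      case False
      then have n: "0 \<le> n" "n \<le> c * p" by (auto simp: n_def)
      have "norm (grad m x' + p *\<^sub>R s + (\<sigma> * d * n\<^sup>2) *\<^sub>R s) \<le> K * n\<^sup>2"
        using grad_step_norm_le[OF minimizer \<open>\<alpha>2 > 0\<close> K[OF step(2)]] unfolding x' d(1,4) n_def
        by (simp add: algebra_simps)
      moreover have "norm (p *\<^sub>R s) = p * n" "norm ((\<sigma> * d * n\<^sup>2) *\<^sub>R s) = \<sigma> * d * n ^ 3"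
        using sd_nonneg \<open>p > 0\<close>
        by (simp_all add: n_def power2_eq_square power3_eq_cube abs_mult[of "\<sigma> * d"])
      ultimately have "norm (grad m x') \<le> p * n + K * n\<^sup>2 + \<sigma> * d * n ^ 3"
        using norm_triangle_ineq4[of "grad m x' + p *\<^sub>R s + (\<sigma> * d * n\<^sup>2) *\<^sub>R s" "(\<sigma> * d * n\<^sup>2) *\<^sub>R s"]
          norm_triangle_ineq4[of "grad m x' + p *\<^sub>R s" "p *\<^sub>R s"] by simp
      also have "\<dots> \<le> p * (c * p) + K * (c * p)\<^sup>2 + D / p * (c * p) ^ 3"
        using n sd(2) \<open>p > 0\<close> \<open>K > 0\<close> \<open>D > 0\<close> by (intro add_mono mult_mono power_mono) auto
      also have "\<dots> = (c * p\<^sup>2) * (1 + K * c + D * c\<^sup>2)"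
        using \<open>p > 0\<close> by (simp add: field_simps power2_eq_square power3_eq_cube)
      also have "\<dots> \<le> (c * p\<^sup>2) * (1 + K * 1 + D * 1)"
        using c \<open>K > 0\<close> \<open>D > 0\<close> by (intro mult_left_mono add_mono power_le_one) auto
      also have "\<dots> = (c * (1 + K + D)) * p\<^sup>2" by simp
      also have "\<dots> \<le> \<rho> * \<gamma>"
        using c_sum \<open>p\<^sup>2 \<le> \<gamma>\<close> \<open>K > 0\<close> \<open>D > 0\<close> assms by (intro mult_mono) auto
      finally show ?thesis by (simp add: \<gamma>_def)
    qed
  qed
qed

subsection \<open>The locally strictly convex case\<close>

text \<open>Three situations: a step longer than \<open>c * sqrt \<epsilon>\<close> decreases
  \<open>m\<close> by convexity; a short step with small \<open>a\<close> is close to a Newton step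
  and shrinks the gradient; a short step with large \<open>a\<close> occurs only when the gradient
  is large relative to \<open>lc\<close>, and then decreases \<open>m\<close>.\<close>

lemma strictly_convex_decrease:
  assumes "\<rho> > 0" "\<rho> < 1"
  obtains c where "c > 0"
    "\<And>\<epsilon> lc x x'. \<lbrakk>qqr_step \<kappa> \<sigma> L m \<epsilon> lc \<eta> x x'; norm x \<le> R; \<epsilon> > 0; 0 < lc; \<epsilon> \<le> 1; lc ^ 3 = \<epsilon>;
      norm (grad m x) > \<epsilon>; lambda_min (hess m x) \<ge> lc\<rbrakk>
      \<Longrightarrow> c * lc ^ 4 \<le> m x - m x' \<or> norm (grad m x') \<le> \<rho> * norm (grad m x)"
proof -
  obtain K where "K > 0" and K: "\<And>x s. norm x \<le> R \<Longrightarrow>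
      norm (grad m (x + s) - grad m x - hess m x *v s - (\<sigma> * norm s ^ 2) *\<^sub>R s) \<le> K * norm s ^ 2"
    using grad_m3_taylor_bounded_on_cball[OF H_sym T_sym sigma_pos, of R f0 g] by blast
  obtain B where "B > 0" and B: "\<And>x v. norm x \<le> R \<Longrightarrow> norm (hess m x *v v) \<le> B * norm v"
    using hess_m3_bounded_on_cball[OF H_sym T_sym sigma_pos, of R f0 g] by blast
  define D where "D = \<kappa> * L\<^sup>2 / 18"
  have "D > 0" using kappa_gt_1 L_pos by (simp add: D_def)
  define c where "c = min 1 (\<rho> / (4 * (K + \<sigma> + D)))"
  have c: "0 < c" "c \<le> 1" "c \<le> \<rho> / (4 * (K + \<sigma> + D))"
    using assms \<open>K > 0\<close> \<open>D > 0\<close> sigma_pos by (auto simp: c_def)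
  then have c_sum: "c * (K + \<sigma> + D) \<le> \<rho> / 4"
    using \<open>K > 0\<close> \<open>D > 0\<close> sigma_pos by (simp add: pos_le_divide_eq algebra_simps)
  \<comment> \<open>The first entry serves long steps, the second short steps with large
    \<open>a\<close>; 10240 is 160 times the 64 from \<open>(\<rho> * lc / 4) ^ 3\<close>.\<close>
  define c1 where "c1 = min (c\<^sup>2 / 2) (9 * \<rho> ^ 4 / (10240 * B))"
  show thesis
  proof
    show "c1 > 0" using assms(1) c(1) \<open>B > 0\<close> by (simp add: c1_def)
    fix \<epsilon> lc x x'
    assume step: "qqr_step \<kappa> \<sigma> L m \<epsilon> lc \<eta> x x'" "norm x \<le> R" "\<epsilon> > 0" "0 < lc"
      and "\<epsilon> \<le> 1" and lc3: "lc ^ 3 = \<epsilon>"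
      and grad: "norm (grad m x) > \<epsilon>" and convex: "lambda_min (hess m x) \<ge> lc"
    obtain \<alpha>1 \<alpha>2 p s where
      params: "qqr_parameters \<kappa> \<sigma> L \<epsilon> lc \<eta> (grad m x) (hess m x) \<alpha>1 \<alpha>2 p"
      and minimizer: "is_arg_min (quad_quartic_model \<sigma> m \<alpha>1 \<alpha>2 p x) (\<lambda>_. True) s"
      and "\<alpha>2 > 0" and x': "x' = x + s"
      and decrease: "\<not> lambda_min (hess m x) \<le> - lc \<Longrightarrow> m x' \<le> quad_quartic_model \<sigma> m \<alpha>1 \<alpha>2 p x s"
      using qqr_stepE[OF step grad] by metis
    from params convex obtain a d where d: "p = 0" "\<alpha>1 = 1 + a" "sqrt \<epsilon> \<le> a * lc"
      "a * lc \<le> sqrt (norm (grad m x))"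
      "\<alpha>2 = 1 + d" "d \<le> \<kappa> * (L^2 / (18 * a * lc * \<sigma>))" "L^2 / (18 * a * lc * \<sigma>) < d"
      unfolding qqr_parameters_def admissible_def by blast
    define n where "n = norm s"
    define \<gamma> where "\<gamma> = norm (grad m x)"
    define r where "r = sqrt \<epsilon>"
    define h where "h = norm (hess m x *v s)"
    define Q where "Q = s \<bullet> (hess m x *v s)"
    have r: "r > 0" "r \<le> 1" "r\<^sup>2 = \<epsilon>" using \<open>\<epsilon> > 0\<close> \<open>\<epsilon> \<le> 1\<close> by (auto simp: r_def)
    have "\<gamma> > \<epsilon>" using grad by (simp add: \<gamma>_def)
    have "h \<ge> 0" "n \<ge> 0" by (auto simp: h_def n_def)
    have "a * lc > 0" using d(3) r(1) unfolding r_def by linarith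
    then have "a > 0" using \<open>lc > 0\<close> by (simp add: zero_less_mult_iff)
    have Q_lower: "lc * norm v ^ 2 \<le> v \<bullet> (hess m x *v v)" for v
      using lambda_min_le_quadratic[OF transpose_hess_m3[OF H_sym T_sym], of f0 g \<sigma> x v]
        mult_right_mono[OF convex, of "norm v ^ 2"] by simp
    have Q_nonneg: "0 \<le> v \<bullet> (hess m x *v v)" for v
      by (rule order_trans[OF _ Q_lower]) (use \<open>lc > 0\<close> in simp)
    have h_le: "h\<^sup>2 \<le> B * Q"
      unfolding h_def Q_def using norm_matrix_vector_mult_square_le[OF transpose_hess_m3[OF H_sym T_sym]
        Q_nonneg B[OF step(2)] \<open>B > 0\<close>] .
    have decrease_ge: "(1 + a) / 2 * Q \<le> m x - m x'"
    proof -
      have "0 \<le> 3/4 * \<sigma> * \<alpha>2 * norm s ^ 4" using sigma_pos \<open>\<alpha>2 > 0\<close> by simp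
      then have "(1 + a) / 2 * Q \<le> m x - quad_quartic_model \<sigma> m \<alpha>1 \<alpha>2 p x s"
        using model_decrease_eq[OF minimizer \<open>\<alpha>2 > 0\<close>] unfolding d(1,2) by (simp add: Q_def)
      then show ?thesis using decrease convex \<open>lc > 0\<close> by linarith
    qed
    have sd: "\<sigma> * \<alpha>2 \<le> (\<sigma> + D) / r"
    proof -
      have "\<sigma> * d \<le> D / (a * lc)"
        using d(6) \<open>a > 0\<close> \<open>lc > 0\<close> sigma_pos by (simp add: D_def field_simps)
      also have "\<dots> \<le> D / r"
        using d(3) \<open>D > 0\<close> r(1) \<open>a * lc > 0\<close> unfolding r_def by (intro divide_left_mono) auto
      finally have "\<sigma> * d \<le> D / r" .
      moreover have "\<sigma> \<le> \<sigma> / r" using sigma_pos r by (simp add: field_simps)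
      ultimately show ?thesis unfolding d(5) by (simp add: add_divide_distrib distrib_left)
    qed
    show "c1 * lc ^ 4 \<le> m x - m x' \<or> norm (grad m x') \<le> \<rho> * norm (grad m x)"
    proof (cases "c * r \<le> n")
      case True
      have "c1 * lc ^ 4 \<le> c\<^sup>2 / 2 * lc ^ 4"
        using \<open>lc > 0\<close> by (intro mult_right_mono) (auto simp: c1_def)
      \<comment> \<open>Here \<open>r^2 = \<epsilon> = lc^3\<close>, so the curvature
        \<open>lc\<close> times the squared step threshold has order \<open>lc^4\<close>.\<close>
      also have "\<dots> = 1/2 * (lc * (c * r)\<^sup>2)"
        unfolding power_mult_distrib r(3) lc3[symmetric]
        by (simp add: power2_eq_square power3_eq_cube power4_eq_xxxx)
      also have "\<dots> \<le> 1/2 * (lc * n\<^sup>2)"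
        using True c r \<open>lc > 0\<close> by (intro mult_left_mono power_mono) auto
      also have "\<dots> \<le> 1/2 * Q" using Q_lower[of s] by (simp add: n_def Q_def)
      also have "\<dots> \<le> (1 + a) / 2 * Q"
        using \<open>a > 0\<close> Q_nonneg[of s] by (intro mult_right_mono) (auto simp: Q_def)
      finally show ?thesis using decrease_ge by linarith
    next
      case False
      then have "n \<le> c * r" by simp
      have quartic_small: "\<sigma> * \<alpha>2 * n ^ 3 \<le> c * (\<sigma> + D) * \<epsilon>"
      proof -
        have "\<sigma> * \<alpha>2 * n ^ 3 \<le> (\<sigma> + D) / r * (c * r) ^ 3"
          using sd \<open>n \<le> c * r\<close> \<open>n \<ge> 0\<close> sigma_pos \<open>D > 0\<close> r(1)
          by (intro mult_mono power_mono) auto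
        also have "\<dots> = c\<^sup>2 * (c * (\<sigma> + D) * \<epsilon>)"
          using r(1) unfolding r(3)[symmetric] by (simp add: field_simps power2_eq_square power3_eq_cube)
        also have "\<dots> \<le> 1 * (c * (\<sigma> + D) * \<epsilon>)"
          using c sigma_pos \<open>D > 0\<close> \<open>\<epsilon> > 0\<close> by (intro mult_right_mono power_le_one) auto
        finally show ?thesis by simp
      qed
      have quadratic_small: "K * n\<^sup>2 \<le> c * K * \<epsilon>"
      proof -
        have "K * n\<^sup>2 \<le> K * (c * r)\<^sup>2"
          using \<open>n \<le> c * r\<close> \<open>n \<ge> 0\<close> \<open>K > 0\<close> by (intro mult_left_mono power_mono) auto
        also have "\<dots> = c * (c * K * \<epsilon>)"
          unfolding power_mult_distrib r(3) by (simp add: power2_eq_square)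
        also have "\<dots> \<le> 1 * (c * K * \<epsilon>)"
          using c \<open>K > 0\<close> \<open>\<epsilon> > 0\<close> by (intro mult_right_mono) auto
        finally show ?thesis by simp
      qed
      have "c * (K + \<sigma> + D) * \<epsilon> \<le> \<rho> / 4 * \<gamma>"
        using c_sum \<open>\<epsilon> > 0\<close> \<open>\<gamma> > \<epsilon>\<close> assms(1) by (intro mult_mono) auto
      then have small: "\<sigma> * \<alpha>2 * n ^ 3 + K * n\<^sup>2 \<le> \<rho> / 4 * \<gamma>"
        using quartic_small quadratic_small by (simp add: algebra_simps)
      have "0 \<le> K * n\<^sup>2" using \<open>K > 0\<close> by simp
      moreover have "\<rho> / 4 * \<gamma> \<le> 1 / 4 * \<gamma>"
        using assms(2) \<open>\<gamma> > \<epsilon>\<close> \<open>\<epsilon> > 0\<close> by (intro mult_right_mono) auto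
      \<comment> \<open>The quartic term is thus a minor part of the stationarity equation, so
        \<open>(1 + a) * h\<close> lies between 3/4 and 5/4 of \<open>\<gamma>\<close>.\<close>
      ultimately have quarter: "\<sigma> * \<alpha>2 * n ^ 3 \<le> 1/4 * \<gamma>" using small by linarith
      have cubic_norm: "norm ((\<sigma> * \<alpha>2 * n\<^sup>2) *\<^sub>R s) = \<sigma> * \<alpha>2 * n ^ 3"
        using sigma_pos \<open>\<alpha>2 > 0\<close> by (simp add: n_def power2_eq_square power3_eq_cube)
      have scaled_norm: "norm ((1 + a) *\<^sub>R (hess m x *v s)) = (1 + a) * h"
        using \<open>a > 0\<close> by (simp add: h_def)
      have "grad m x + (1 + a) *\<^sub>R (hess m x *v s) = - ((\<sigma> * \<alpha>2 * n\<^sup>2) *\<^sub>R s)"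
        using step_stationary[OF minimizer \<open>\<alpha>2 > 0\<close>] unfolding d(1,2) n_def
        by (simp add: eq_neg_iff_add_eq_0)
      then have sum_norm: "norm (grad m x + (1 + a) *\<^sub>R (hess m x *v s)) = \<sigma> * \<alpha>2 * n ^ 3"
        using cubic_norm by simp
      have upper: "(1 + a) * h \<le> 5/4 * \<gamma>"
        using norm_triangle_ineq4[of "grad m x + (1 + a) *\<^sub>R (hess m x *v s)" "grad m x"]
          sum_norm scaled_norm quarter by (simp add: \<gamma>_def)
      have lower: "3/4 * \<gamma> \<le> (1 + a) * h"
        using norm_triangle_ineq4[of "grad m x + (1 + a) *\<^sub>R (hess m x *v s)" "(1 + a) *\<^sub>R (hess m x *v s)"]
          sum_norm scaled_norm quarter by (simp add: \<gamma>_def)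
      show ?thesis
      \<comment> \<open>For small \<open>a\<close> the new gradient is at most
        \<open>\<rho> / 4 * (5/4 + 1) * \<gamma>\<close>. For large \<open>a\<close>,
        \<open>a * lc \<le> sqrt \<gamma>\<close> bounds \<open>\<gamma>\<close> from below.\<close>
      proof (cases "a \<le> \<rho> / 4")
        case True
        have "norm (grad m x' + a *\<^sub>R (hess m x *v s) + (\<sigma> * (\<alpha>2 - 1) * n\<^sup>2) *\<^sub>R s) \<le> K * n\<^sup>2"
          using grad_step_norm_le[OF minimizer \<open>\<alpha>2 > 0\<close> K[OF step(2)]] unfolding x' d(1,2) n_def
          by (simp add: algebra_simps)
        moreover have "norm ((\<sigma> * (\<alpha>2 - 1) * n\<^sup>2) *\<^sub>R s) \<le> \<sigma> * \<alpha>2 * n ^ 3"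
        proof -
          have "0 \<le> L^2 / (18 * a * lc * \<sigma>)" using \<open>a > 0\<close> \<open>lc > 0\<close> sigma_pos by simp
          with d(7) have "d > 0" by linarith
          then have "norm ((\<sigma> * (\<alpha>2 - 1) * n\<^sup>2) *\<^sub>R s) = \<sigma> * d * n ^ 3"
            using sigma_pos by (simp add: d(5) n_def power2_eq_square power3_eq_cube)
          also have "\<dots> \<le> \<sigma> * \<alpha>2 * n ^ 3"
            using sigma_pos \<open>n \<ge> 0\<close> by (intro mult_right_mono) (auto simp: d(5))
          finally show ?thesis .
        qed
        ultimately have "norm (grad m x') \<le> a * h + (\<sigma> * \<alpha>2 * n ^ 3 + K * n\<^sup>2)"
          using norm_triangle_ineq4[of "grad m x' + a *\<^sub>R (hess m x *v s) + (\<sigma> * (\<alpha>2 - 1) * n\<^sup>2) *\<^sub>R s" "(\<sigma> * (\<alpha>2 - 1) * n\<^sup>2) *\<^sub>R s"]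
            norm_triangle_ineq4[of "grad m x' + a *\<^sub>R (hess m x *v s)" "a *\<^sub>R (hess m x *v s)"] \<open>a > 0\<close>
          by (simp add: h_def)
        also have "a * h \<le> \<rho> / 4 * ((1 + a) * h)"
          using True \<open>a > 0\<close> \<open>h \<ge> 0\<close> assms by (intro mult_mono) (auto simp: distrib_right)
        also have "\<dots> \<le> \<rho> / 4 * (5/4 * \<gamma>)"
          using upper assms by (intro mult_left_mono) auto
        finally have "norm (grad m x') \<le> \<rho> / 4 * (5/4 * \<gamma>) + \<rho> / 4 * \<gamma>" using small by linarith
        also have "\<dots> \<le> \<rho> * \<gamma>" using assms(1) \<open>\<gamma> > \<epsilon>\<close> \<open>\<epsilon> > 0\<close> by simp
        finally show ?thesis by (simp add: \<gamma>_def)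
      next
        case False
        define w where "w = sqrt \<gamma>"
        have w: "w > 0" "w\<^sup>2 = \<gamma>" using \<open>\<gamma> > \<epsilon>\<close> \<open>\<epsilon> > 0\<close> by (auto simp: w_def)
        have aw: "a * lc \<le> w" using d(4) by (simp add: w_def \<gamma>_def)
        have "\<rho> / 4 * lc \<le> a * lc" using False \<open>lc > 0\<close> by (intro mult_right_mono) auto
        with aw have w_ge: "\<rho> * lc / 4 \<le> w" by simp
        have "\<rho> * a \<le> 1 * a" using assms(2) \<open>a > 0\<close> by (intro mult_right_mono) auto
        \<comment> \<open>From \<open>\<rho> < 4 * a\<close> and \<open>\<rho> * a \<le> a\<close>;
          it yields the upper bound of order \<open>w / lc\<close> on \<open>1 + a\<close>.\<close>
        then have "(1 + a) * \<rho> \<le> 5 * a"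
          using False by (simp add: algebra_simps)
        then have "(1 + a) * \<rho> * lc \<le> 5 * (a * lc)" using \<open>lc > 0\<close> by simp
        then have aw': "(1 + a) * (\<rho> * lc) \<le> 5 * w" using aw by (simp add: mult.assoc)
        \<comment> \<open>The decrease is at least \<open>((1 + a) * h)\<^sup>2 / (2 * B * (1 + a))\<close>, where the
          numerator is of order \<open>w ^ 4\<close> and \<open>1 + a\<close> is of order \<open>w / lc\<close>.\<close>
        have "9 * \<rho> ^ 4 / (10240 * B) * lc ^ 4 = 9 / (160 * B) * (\<rho> * lc * (\<rho> * lc / 4) ^ 3)"
          by (simp add: field_simps power3_eq_cube power4_eq_xxxx)
        also have "\<dots> \<le> 9 / (160 * B) * (\<rho> * lc * w ^ 3)"
          using w_ge \<open>B > 0\<close> assms \<open>lc > 0\<close> by (intro mult_left_mono power_mono) auto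
        also have "\<dots> \<le> (1 + a) / 2 * Q"
        proof -
          have "(3/4 * w\<^sup>2)\<^sup>2 \<le> ((1 + a) * h)\<^sup>2"
            using lower w by (intro power_mono) auto
          also have "\<dots> = (1 + a)\<^sup>2 * h\<^sup>2" by (simp add: power_mult_distrib)
          also have "\<dots> \<le> (1 + a)\<^sup>2 * (B * Q)" using h_le by (intro mult_left_mono) auto
          finally have "(\<rho> * lc) * (9/16 * w ^ 4) \<le> (\<rho> * lc) * ((1 + a)\<^sup>2 * (B * Q))"
            using assms \<open>lc > 0\<close>
            by (intro mult_left_mono) (auto simp: power2_eq_square power4_eq_xxxx)
          also have "\<dots> = ((1 + a) * (\<rho> * lc)) * ((1 + a) * (B * Q))"
            by (simp add: power2_eq_square)
          also have "\<dots> \<le> (5 * w) * ((1 + a) * (B * Q))"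
            using aw' \<open>a > 0\<close> \<open>B > 0\<close> Q_nonneg[of s] by (intro mult_right_mono) (auto simp: Q_def)
          finally have "w * ((\<rho> * lc) * (9/16 * w ^ 3)) \<le> w * (5 * ((1 + a) * (B * Q)))"
            by (simp add: power3_eq_cube power4_eq_xxxx mult_ac)
          then have "(\<rho> * lc) * (9/16 * w ^ 3) \<le> 5 * ((1 + a) * (B * Q))"
            using w(1) by simp
          then show ?thesis using \<open>B > 0\<close> by (simp add: field_simps)
        qed
        finally have "9 * \<rho> ^ 4 / (10240 * B) * lc ^ 4 \<le> m x - m x'" using decrease_ge by linarith
        moreover have "c1 * lc ^ 4 \<le> 9 * \<rho> ^ 4 / (10240 * B) * lc ^ 4"
          using \<open>lc > 0\<close> by (intro mult_right_mono) (auto simp: c1_def)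
        ultimately show ?thesis by linarith
      qed
    qed
  qed
qed

end

section \<open>Combination of the three cases\<close>

theorem mainTheorem1:
  fixes f0 \<sigma> \<eta> \<rho>l \<kappa> :: real
    and g :: "real^'n"
    and H :: "real^'n^'n"
    and T :: "real^'n^'n^'n"
    and m :: "real^'n \<Rightarrow> real"
  assumes "transpose H = H"
    and "symmetric_tensor T"
    and "\<sigma> > 0"
    and "m = m3 f0 g H T \<sigma>"
    and "0 < \<eta>" and "\<eta> < 1/3"
    and "0 < \<rho>l" and "\<rho>l < 1"
    and "\<kappa> > 1"
  shows "\<exists>c1>0. \<exists>c2>0. \<exists>c2'>0. \<exists>c3>0.
    \<forall>\<epsilon> lc s i.
      0 < \<epsilon> \<and> \<epsilon> < 1 \<and> lc = \<epsilon> powr (1/3) \<and>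
      qqr_sequence \<kappa> \<sigma> (LH g H T \<sigma>) m \<epsilon> lc \<eta> s \<and>
      norm (grad m (s i)) > \<epsilon> \<and> norm (grad m (s (Suc i))) > \<epsilon>
      \<longrightarrow>
      (lambda_min (hess m (s i)) \<ge> lc \<longrightarrow>
         m (s i) - m (s (Suc i)) \<ge> c1 * \<epsilon> powr (4/3) \<or>
         norm (grad m (s (Suc i))) \<le> \<rho>l * norm (grad m (s i))) \<and>
      (lambda_min (hess m (s i)) \<le> - lc \<longrightarrow>
         m (s i) - m (s (Suc i)) \<ge> c2 * \<epsilon> \<or>
         m (s i) - m (s (Suc i)) \<ge> c2') \<and>
      (\<bar>lambda_min (hess m (s i))\<bar> < lc \<longrightarrow>
         m (s i) - m (s (Suc i)) \<ge> c3 * \<epsilon> powr (3/2) \<or>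
         norm (grad m (s (Suc i))) \<le> \<rho>l * norm (grad m (s i)))"
\<comment> \<open>For \<open>g = 0\<close> the sequence stays at the origin, where the gradient
  vanishes, so no iteration satisfies the premises.\<close>
proof (cases "g = 0")
  case True
  have "grad m 0 = 0"
    by (simp add: \<open>m = m3 f0 g H T \<sigma>\<close> grad_m3[OF assms(1,2)] True tensor_apply_def vec_eq_iff)
  have False
    if "0 < \<epsilon>" "qqr_sequence \<kappa> \<sigma> (LH g H T \<sigma>) m \<epsilon> lc \<eta> s" "norm (grad m (s i)) > \<epsilon>"
    for \<epsilon> lc s i
  proof -
    have "s i = 0" for i
    proof (induction i)
      case (Suc i)
      then show ?case
        using that(1,2) \<open>grad m 0 = 0\<close> unfolding qqr_sequence_def by (metis norm_zero not_less_iff_gr_or_eq)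
    qed (use that(2) in \<open>simp add: qqr_sequence_def\<close>)
    with that(1,3) \<open>grad m 0 = 0\<close> show False by simp
  qed
  then show ?thesis by (intro exI[of _ "1::real"] conjI zero_less_one allI impI; blast)
next
  case False
  interpret qqr_problem f0 \<sigma> \<eta> \<kappa> g H T
    using assms False by unfold_locales
  note m_eq = \<open>m = m3 f0 g H T \<sigma>\<close>
  obtain c1 where c1: "c1 > 0"
    "\<And>\<epsilon> lc x x'. \<lbrakk>qqr_step \<kappa> \<sigma> L m \<epsilon> lc \<eta> x x'; norm x \<le> R; \<epsilon> > 0; 0 < lc; \<epsilon> \<le> 1; lc ^ 3 = \<epsilon>;
      norm (grad m x) > \<epsilon>; lambda_min (hess m x) \<ge> lc\<rbrakk>
      \<Longrightarrow> c1 * lc ^ 4 \<le> m x - m x' \<or> norm (grad m x') \<le> \<rho>l * norm (grad m x)"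
    using strictly_convex_decrease[OF \<open>0 < \<rho>l\<close> \<open>\<rho>l < 1\<close>] unfolding m_eq by metis
  obtain c2 where c2: "c2 > 0"
    "\<And>\<epsilon> lc x x'. \<lbrakk>qqr_step \<kappa> \<sigma> L m \<epsilon> lc \<eta> x x'; norm x \<le> R; \<epsilon> > 0; 0 < lc; lc \<le> 1;
      norm (grad m x) > \<epsilon>; lambda_min (hess m x) \<le> - lc\<rbrakk> \<Longrightarrow> c2 * lc ^ 3 \<le> m x - m x'"
    using nonconvex_decrease unfolding m_eq by metis
  obtain c3 where c3: "c3 > 0"
    "\<And>\<epsilon> lc x x'. \<lbrakk>qqr_step \<kappa> \<sigma> L m \<epsilon> lc \<eta> x x'; norm x \<le> R; \<epsilon> > 0; 0 < lc;
      norm (grad m x) > \<epsilon>; \<bar>lambda_min (hess m x)\<bar> < lc\<rbrakk>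
      \<Longrightarrow> c3 * sqrt \<epsilon> ^ 3 \<le> m x - m x' \<or> norm (grad m x') \<le> \<rho>l * norm (grad m x)"
    using nearly_convex_decrease[OF \<open>0 < \<rho>l\<close>] unfolding m_eq by metis
  show ?thesis
  \<comment> \<open>The witness 1 for \<open>c2'\<close> is arbitrary, because
    \<open>nonconvex_decrease\<close> always yields the first alternative.\<close>
  proof (rule exI[of _ c1], rule conjI[OF c1(1)], rule exI[of _ c2], rule conjI[OF c2(1)],
      rule exI[of _ 1], rule conjI[OF zero_less_one], rule exI[of _ c3], rule conjI[OF c3(1)],
      intro allI impI, elim conjE, intro conjI impI)
    fix \<epsilon> lc s i
    assume eps: "0 < \<epsilon>" "\<epsilon> < 1" and lc: "lc = \<epsilon> powr (1/3)"
      and seq: "qqr_sequence \<kappa> \<sigma> L m \<epsilon> lc \<eta> s" and grad: "norm (grad m (s i)) > \<epsilon>"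
    have step: "qqr_step \<kappa> \<sigma> L m \<epsilon> lc \<eta> (s i) (s (Suc i))"
      using seq grad unfolding qqr_sequence_def by metis
    have x: "norm (s i) \<le> R"
      using seq unfolding m_eq by (rule qqr_sequence_norm_le)
    have lc_pos: "0 < lc" using eps lc by simp
    have "lc \<le> 1" using eps unfolding lc by (intro powr_le1) auto
    have lc3: "lc ^ 3 = \<epsilon>" using eps by (simp add: lc powr_power)
    have lc4: "lc ^ 4 = \<epsilon> powr (4/3)" using eps by (simp add: lc powr_power)
    have sqrt3: "sqrt \<epsilon> ^ 3 = \<epsilon> powr (3/2)"
      using eps by (simp add: powr_half_sqrt[symmetric] powr_power)
    {
      assume "lambda_min (hess m (s i)) \<ge> lc"
      then show "m (s i) - m (s (Suc i)) \<ge> c1 * \<epsilon> powr (4/3) \<or>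
         norm (grad m (s (Suc i))) \<le> \<rho>l * norm (grad m (s i))"
        using c1(2)[OF step x eps(1) lc_pos _ lc3 grad] eps(2) unfolding lc4 by simp
    next
      assume "lambda_min (hess m (s i)) \<le> - lc"
      then show "m (s i) - m (s (Suc i)) \<ge> c2 * \<epsilon> \<or> m (s i) - m (s (Suc i)) \<ge> 1"
        using c2(2)[OF step x eps(1) lc_pos \<open>lc \<le> 1\<close> grad] unfolding lc3 by simp
    next
      assume "\<bar>lambda_min (hess m (s i))\<bar> < lc"
      then show "m (s i) - m (s (Suc i)) \<ge> c3 * \<epsilon> powr (3/2) \<or>
         norm (grad m (s (Suc i))) \<le> \<rho>l * norm (grad m (s i))"
        using c3(2)[OF step x eps(1) lc_pos grad] unfolding sqrt3 by simp
    }
  qed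
qed

end
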